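(* Let $\{\varepsilon_{k,\ell}: k,\ell\in\mathbb{N}\}$ be independent random variables with $\mathsf{E}\,\varepsilon_{k,\ell}=0$ and $\mathrm{Var}\,\varepsilon_{k,\ell}=1$. Let $\{X_{k,\ell}: k,\ell\in\mathbb{Z},\ k,\ell\ge 0\}$ be the spatial autoregressive process with real parameters $\alpha,\beta,\gamma$ defined by $$X_{k,\ell}=\alpha X_{k-1,\ell}+\beta X_{k,\ell-1}+\gamma X_{k-1,\ell-1}+\varepsilon_{k,\ell}\quad\text{for } k,\ell\ge 1,\qquad X_{k,0}=X_{0,\ell}=0\quad\text{for } k,\ell\ge 0.$$ For $n\in\mathbb{N}$ consider the piecewise constant random field $$Y^{(n)}(s,t):=X_{[ns],[nt]},\qquad s,t\in\mathbb{R},\ s,t\ge 0.$$ (i) If $|\alpha|<1$, $|\beta|<1$ and $|\gamma|<1$, $|1+\alpha^2-\beta^2-\gamma^2|>2|\alpha+\beta\gamma|$ and $1-\beta^2>|\alpha+\beta\gamma|$, then $$\lim_{n\to\infty}\mathrm{Var}\big(Y^{(n)}(s,t)\big)=\sigma^2_{\alpha,\beta,\gamma}:=\big((1+\alpha+\beta-\gamma)(1+\alpha-\beta+\gamma)(1-\alpha+\beta+\gamma)(1-\alpha-\beta-\gamma)\big)^{-1/2}.$$ (ii) If $|\alpha|<1$, $|\beta|<1$ and $|\gamma|<1$, and in case $\alpha\beta\gamma\ge 0$ the equation $|\alpha|+|\beta|+|\gamma|=1$ holds, while in case $\alpha\beta\gamma<0$ the equation $|\alpha|+|\beta|-|\gamma|=1$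 holds, then $$\lim_{n\to\infty}\frac{1}{n^{1/2}}\mathrm{Var}\big(Y^{(n)}(s,t)\big)=\frac{\big((1-|\alpha|)s\big)^{1/2}\land\big((1-|\beta|)t\big)^{1/2}}{\pi^{1/2}(|\alpha|+|\beta|)^{1/2}(1-|\alpha|)(1-|\beta|)}.$$ (iii) If $\alpha\beta\gamma\le 0$ and $|\alpha|=1$, $|\beta|=|\gamma|<1$, or $|\beta|=1$, $|\alpha|=|\gamma|<1$, then $$\lim_{n\to\infty}\frac1n\mathrm{Var}\big(Y^{(n)}(s,t)\big)=\frac{s}{1-\gamma^2}\qquad\text{or}\qquad\lim_{n\to\infty}\frac1n\mathrm{Var}\big(Y^{(n)}(s,t)\big)=\frac{t}{1-\gamma^2},$$ respectively. (iv) If $\alpha\beta\gamma=-1$ and $|\alpha|=|\beta|=|\gamma|=1$, then $$\lim_{n\to\infty}\frac1{n^2}\mathrm{Var}\big(Y^{(n)}(s,t)\big)=st.$$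
   Context: $\mathbb{N}=\{1,2,\dots\}$; $[x]$ denotes the integer part of $x\ge 0$; $x\land y:=\min\{x,y\}$.
   Formalization: Part (i) is stated for s,t>0, and part (iii) for t>0 (first case) respectively s>0 (second case), since the field vanishes when s=0 or t=0 and the claimed limits then fail (except trivially at s=t=0 in (iii)). *)

theory Defs
  imports "HOL-Probability.Probability"
begin

text \<open>
  The innovations are \<open>e k l\<close>; only those with \<open>k, l \<ge> 1\<close> are ever used, so the values
  \<open>e 0 l\<close> and \<open>e k 0\<close> are irrelevant.
\<close>

fun spatial_ar ::
  "real \<Rightarrow> real \<Rightarrow> real \<Rightarrow> (nat \<Rightarrow> nat \<Rightarrow> 'a \<Rightarrow> real) \<Rightarrow> nat \<Rightarrow> nat \<Rightarrow> 'a \<Rightarrow> real" where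
  "spatial_ar \<alpha> \<beta> \<gamma> e 0 l = (\<lambda>\<omega>. 0)"
| "spatial_ar \<alpha> \<beta> \<gamma> e k 0 = (\<lambda>\<omega>. 0)"
| "spatial_ar \<alpha> \<beta> \<gamma> e (Suc k) (Suc l) =
     (\<lambda>\<omega>. \<alpha> * spatial_ar \<alpha> \<beta> \<gamma> e k (Suc l) \<omega> + \<beta> * spatial_ar \<alpha> \<beta> \<gamma> e (Suc k) l \<omega>
          + \<gamma> * spatial_ar \<alpha> \<beta> \<gamma> e k l \<omega> + e (Suc k) (Suc l) \<omega>)"

definition ar_field ::
  "real \<Rightarrow> real \<Rightarrow> real \<Rightarrow> (nat \<Rightarrow> nat \<Rightarrow> 'a \<Rightarrow> real) \<Rightarrow> nat \<Rightarrow> real \<Rightarrow> real \<Rightarrow> 'a \<Rightarrow> real" where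
  "ar_field \<alpha> \<beta> \<gamma> e n s t = spatial_ar \<alpha> \<beta> \<gamma> e (nat \<lfloor>real n * s\<rfloor>) (nat \<lfloor>real n * t\<rfloor>)"

definition stationary_variance :: "real \<Rightarrow> real \<Rightarrow> real \<Rightarrow> real" where
  "stationary_variance \<alpha> \<beta> \<gamma> =
     ((1 + \<alpha> + \<beta> - \<gamma>) * (1 + \<alpha> - \<beta> + \<gamma>) * (1 - \<alpha> + \<beta> + \<gamma>) * (1 - \<alpha> - \<beta> - \<gamma>)) powr (-1/2)"

end

theory Submission
  imports Defs
begin

text \<open>
  The field is a moving average of the innovations with the Green function \<open>G = green \<alpha> \<beta> \<gamma>\<close> of the recursion
  as weights, so \<open>Var (X k l)\<close> is the sum of \<open>(G i j)\<^sup>2\<close> over \<open>i < k\<close>, \<open>j < l\<close>. The generating function of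
  \<open>G i j\<close> in \<open>i\<close> is \<open>(\<beta> + \<gamma> z)\<^sup>j / (1 - \<alpha> z)\<^sup>j\<^sup>+\<^sup>1\<close>, and Parseval's identity turns a row sum of squares into
  an integral over the unit circle.

  In case (i) the geometric series of the row integrands collapses the total to a Poisson kernel
  integral. In case (ii) sign changes reduce to \<open>\<alpha>, \<beta> \<ge> 0\<close>, \<open>\<alpha> + \<beta> + \<gamma> = 1\<close>; then \<open>(1 - \<alpha>) G i j\<close>
  is the law of a random walk with nonnegative steps of mean \<open>\<mu> = (1 - \<beta>) / (1 - \<alpha>)\<close> after \<open>j\<close> steps plus
  an independent geometric variable. Laplace's method shows that the full row sums decay like a
  constant times \<open>1 / \<surd>j\<close>, and a Chernoff bound shows that a row is captured by \<open>i < k\<close> almost entirely if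
  \<open>\<mu> j < k\<close> and hardly at all if \<open>\<mu> j > k\<close>. Hence the variance behaves like the sum of the first
  \<open>min l (k / \<mu>)\<close> row sums. In cases (iii) and (iv) \<open>\<gamma> = - \<alpha> \<beta>\<close>, so \<open>G i j = \<alpha>\<^sup>i \<beta>\<^sup>j\<close>.
\<close>

section \<open>Moving average representation\<close>

text \<open>\<open>i\<close> and \<open>j\<close> are lags: the unit impulse sits at the origin,
  whereas the first innovation entering \<open>spatial_ar\<close> has index (1, 1). The boundary
  clauses are the general recursion with value 0 outside the quadrant.\<close>

fun green :: "real \<Rightarrow> real \<Rightarrow> real \<Rightarrow> nat \<Rightarrow> nat \<Rightarrow> real" where
  "green \<alpha> \<beta> \<gamma> 0 0 = 1"
| "green \<alpha> \<beta> \<gamma> (Suc i) 0 = \<alpha> * green \<alpha> \<beta> \<gamma> i 0"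
| "green \<alpha> \<beta> \<gamma> 0 (Suc j) = \<beta> * green \<alpha> \<beta> \<gamma> 0 j"
| "green \<alpha> \<beta> \<gamma> (Suc i) (Suc j) =
     \<alpha> * green \<alpha> \<beta> \<gamma> i (Suc j) + \<beta> * green \<alpha> \<beta> \<gamma> (Suc i) j + \<gamma> * green \<alpha> \<beta> \<gamma> i j"

text \<open>With \<open>i\<close> summed inside, the inner sums are truncations of the series
  \<open>row_energy\<close>.\<close>

definition green_energy :: "real \<Rightarrow> real \<Rightarrow> real \<Rightarrow> nat \<Rightarrow> nat \<Rightarrow> real" where
  "green_energy \<alpha> \<beta> \<gamma> k l = (\<Sum>j<l. \<Sum>i<k. (green \<alpha> \<beta> \<gamma> i j)\<^sup>2)"

lemma green_col_0: "green \<alpha> \<beta> \<gamma> i 0 = \<alpha> ^ i"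
  by (induction i) auto

lemma green_row_0: "green \<alpha> \<beta> \<gamma> 0 j = \<beta> ^ j"
  by (induction j) auto

text \<open>Here 1 - \<alpha> x - \<beta> y - \<gamma> x y splits as (1 - \<alpha> x)(1 - \<beta>
  y), so the bivariate generating function is a product of two geometric series.\<close>

lemma green_product:
  assumes "\<gamma> = - \<alpha> * \<beta>"
  shows "green \<alpha> \<beta> \<gamma> i j = \<alpha> ^ i * \<beta> ^ j"
  using assms by (induction \<alpha> \<beta> \<gamma> i j rule: green.induct) (auto simp: algebra_simps)

text \<open>The three terms of the recursion pick up the factors \<epsilon>, \<delta> and \<epsilon>
  \<delta>, which is how \<epsilon>^i \<delta>^j changes under the corresponding shifts. This later
  reduces the critical case to nonnegative \<alpha> and \<beta>.\<close>

lemma green_sign_change: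
  assumes "\<epsilon>\<^sup>2 = 1" "\<delta>\<^sup>2 = 1"
  shows "green (\<epsilon> * \<alpha>) (\<delta> * \<beta>) (\<epsilon> * \<delta> * \<gamma>) i j = \<epsilon> ^ i * \<delta> ^ j * green \<alpha> \<beta> \<gamma> i j"
  by (induction \<alpha> \<beta> \<gamma> i j rule: green.induct) (auto simp: algebra_simps)

lemma green_energy_sign_change:
  assumes "\<epsilon>\<^sup>2 = 1" "\<delta>\<^sup>2 = 1"
  shows "green_energy (\<epsilon> * \<alpha>) (\<delta> * \<beta>) (\<epsilon> * \<delta> * \<gamma>) k l = green_energy \<alpha> \<beta> \<gamma> k l"
proof -
  have "(green (\<epsilon> * \<alpha>) (\<delta> * \<beta>) (\<epsilon> * \<delta> * \<gamma>) i j)\<^sup>2 = (green \<alpha> \<beta> \<gamma> i j)\<^sup>2" for i j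
    using assms by (simp add: green_sign_change power_mult_distrib flip: power_mult)
      (simp add: power_mult mult.commute[of _ 2])
  then show ?thesis by (simp add: green_energy_def)
qed

lemma green_energy_product:
  assumes "\<gamma> = - \<alpha> * \<beta>"
  shows "green_energy \<alpha> \<beta> \<gamma> k l = (\<Sum>i<k. (\<alpha>\<^sup>2) ^ i) * (\<Sum>j<l. (\<beta>\<^sup>2) ^ j)"
  unfolding green_energy_def green_product[OF assms]
  by (subst sum.swap) (simp add: sum_product power_mult_distrib flip: power_mult, simp add: mult.commute)

text \<open>On the critical line the increment \<open>green (Suc i) j - \<alpha> * green i j\<close> satisfies a
  recursion with the nonnegative coefficients \<open>\<beta>\<close> and \<open>\<gamma> + \<alpha> * \<beta> = (1 - \<alpha>) * (1 - \<beta>)\<close>,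
  although \<open>\<gamma>\<close> itself may be negative.\<close>

lemma green_nonneg_critical:
  assumes "0 \<le> \<alpha>" "\<alpha> \<le> 1" "0 \<le> \<beta>" "\<beta> \<le> 1" "\<alpha> + \<beta> + \<gamma> = 1"
  shows "0 \<le> green \<alpha> \<beta> \<gamma> i j"
proof -
  have "\<forall>i. 0 \<le> green \<alpha> \<beta> \<gamma> i j \<and> \<alpha> * green \<alpha> \<beta> \<gamma> i j \<le> green \<alpha> \<beta> \<gamma> (Suc i) j" for j
  proof (induction j)
    case 0
    then show ?case using assms by (auto simp: green_col_0)
  next
    case (Suc j)
    have inc: "\<alpha> * green \<alpha> \<beta> \<gamma> i (Suc j) \<le> green \<alpha> \<beta> \<gamma> (Suc i) (Suc j)" for i
    proof -
      have "green \<alpha> \<beta> \<gamma> (Suc i) (Suc j) - \<alpha> * green \<alpha> \<beta> \<gamma> i (Suc j)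
          = \<beta> * (green \<alpha> \<beta> \<gamma> (Suc i) j - \<alpha> * green \<alpha> \<beta> \<gamma> i j) + (\<gamma> + \<alpha> * \<beta>) * green \<alpha> \<beta> \<gamma> i j"
        by (simp add: algebra_simps)
      also have "\<gamma> + \<alpha> * \<beta> = (1 - \<alpha>) * (1 - \<beta>)"
        using assms(5) by (simp add: algebra_simps)
      finally show ?thesis
        using assms Suc.IH
        by (metis add_nonneg_nonneg diff_ge_0_iff_ge mult_nonneg_nonneg)
    qed
    have "0 \<le> green \<alpha> \<beta> \<gamma> i (Suc j)" for i
    proof (induction i)
      case 0
      then show ?case using assms by (simp add: green_row_0)
    next
      case (Suc i)
      then show ?case using inc[of i] assms(1) by (meson mult_nonneg_nonneg order_trans)
    qed
    with inc show ?case by blast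
  qed
  then show ?thesis by blast
qed

lemma spatial_ar_eq_sum_green:
  "spatial_ar \<alpha> \<beta> \<gamma> e k l \<omega> = (\<Sum>i<k. \<Sum>j<l. green \<alpha> \<beta> \<gamma> i j * e (k - i) (l - j) \<omega>)"
proof (induction \<alpha> \<beta> \<gamma> e k l rule: spatial_ar.induct)
  case (3 \<alpha> \<beta> \<gamma> e k l)
  \<comment> \<open>Index 0 is split off at the front of both sums, so that the recursion of
    \<open>green\<close> applies to the rest; since \<open>Suc k - Suc i = k - i\<close>, the sums
    for the three predecessors reappear.\<close>
  then show ?case
    by (simp add: sum.lessThan_Suc_shift sum.distrib sum_distrib_left algebra_simps
        del: sum.lessThan_Suc)
qed auto

section \<open>Variance of a linear combination of the innovations\<close>

context prob_space
begin

lemma variance_sum_uncorrelated: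
  fixes X :: "'i \<Rightarrow> 'a \<Rightarrow> real"
  assumes "finite I"
    and meas: "\<And>i. i \<in> I \<Longrightarrow> random_variable borel (X i)"
    and mean: "\<And>i. i \<in> I \<Longrightarrow> expectation (X i) = 0"
    and sq: "\<And>i. i \<in> I \<Longrightarrow> integrable M (\<lambda>\<omega>. (X i \<omega>)\<^sup>2)"
    and uncor: "\<And>i j. i \<in> I \<Longrightarrow> j \<in> I \<Longrightarrow> i \<noteq> j \<Longrightarrow> expectation (\<lambda>\<omega>. X i \<omega> * X j \<omega>) = 0"
  shows "variance (\<lambda>\<omega>. \<Sum>i\<in>I. c i * X i \<omega>) = (\<Sum>i\<in>I. (c i)\<^sup>2 * expectation (\<lambda>\<omega>. (X i \<omega>)\<^sup>2))"
proof -
  have int: "integrable M (X i)" if "i \<in> I" for i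
    using square_integrable_imp_integrable[OF meas[OF that] sq[OF that]] .
  have prodint: "integrable M (\<lambda>\<omega>. X i \<omega> * X j \<omega>)" if "i \<in> I" "j \<in> I" for i j
  proof (rule Bochner_Integration.integrable_bound)
    show "integrable M (\<lambda>\<omega>. (X i \<omega>)\<^sup>2 + (X j \<omega>)\<^sup>2)"
      using sq that by (intro Bochner_Integration.integrable_add)
    have "norm (a * b) \<le> norm (a\<^sup>2 + b\<^sup>2)" for a b :: real
    proof -
      have "2 * (\<bar>a\<bar> * \<bar>b\<bar>) \<le> a\<^sup>2 + b\<^sup>2" "0 \<le> \<bar>a\<bar> * \<bar>b\<bar>"
        using sum_squares_bound[of "\<bar>a\<bar>" "\<bar>b\<bar>"] by simp_all
      then have "\<bar>a\<bar> * \<bar>b\<bar> \<le> a\<^sup>2 + b\<^sup>2" by linarith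
      then show ?thesis by (simp add: abs_mult)
    qed
    then show "AE \<omega> in M. norm (X i \<omega> * X j \<omega>) \<le> norm ((X i \<omega>)\<^sup>2 + (X j \<omega>)\<^sup>2)" by simp
  qed (use meas that in measurable)
  have "expectation (\<lambda>\<omega>. \<Sum>i\<in>I. c i * X i \<omega>) = 0"
    using int mean by (simp add: Bochner_Integration.integral_sum)
  then have "variance (\<lambda>\<omega>. \<Sum>i\<in>I. c i * X i \<omega>)
      = expectation (\<lambda>\<omega>. \<Sum>i\<in>I. \<Sum>j\<in>I. c i * c j * (X i \<omega> * X j \<omega>))"
    by (simp add: power2_eq_square sum_product algebra_simps)
  also have "\<dots> = (\<Sum>i\<in>I. \<Sum>j\<in>I. c i * c j * expectation (\<lambda>\<omega>. X i \<omega> * X j \<omega>))"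
    using prodint by (simp add: Bochner_Integration.integral_sum)
  also have "\<dots> = (\<Sum>i\<in>I. \<Sum>j\<in>I. if i = j then (c i)\<^sup>2 * expectation (\<lambda>\<omega>. (X i \<omega>)\<^sup>2) else 0)"
    using uncor by (intro sum.cong refl) (auto simp: power2_eq_square)
  finally show ?thesis using \<open>finite I\<close> by simp
qed

lemma variance_spatial_ar:
  fixes e :: "nat \<Rightarrow> nat \<Rightarrow> 'a \<Rightarrow> real"
  assumes indep: "indep_vars (\<lambda>_. borel) (\<lambda>(k, l). e k l) ({1..} \<times> {1..})"
    and mean: "\<And>k l. k \<ge> 1 \<Longrightarrow> l \<ge> 1 \<Longrightarrow> expectation (e k l) = 0"
    and var: "\<And>k l. k \<ge> 1 \<Longrightarrow> l \<ge> 1 \<Longrightarrow> variance (e k l) = 1"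
  shows "variance (spatial_ar \<alpha> \<beta> \<gamma> e k l) = green_energy \<alpha> \<beta> \<gamma> k l"
proof -
  define X where "X = (\<lambda>(i, j). e (k - i) (l - j))"
  define I where "I = {..<k} \<times> {..<l}"
  define J where "J = ({1..} \<times> {1..} :: (nat \<times> nat) set)"
  have "indep_vars (\<lambda>_. borel) (\<lambda>(k, l). e k l) J" using indep by (simp add: J_def)
  then have rv: "random_variable borel (e p q)" if "(p, q) \<in> J" for p q
    using that unfolding indep_vars_def by auto
  have I_J: "(k - i, l - j) \<in> J" if "(i, j) \<in> I" for i j
    using that by (auto simp: I_def J_def)
  have sq1: "expectation (\<lambda>\<omega>. (e p q \<omega>)\<^sup>2) = 1" if "(p, q) \<in> J" for p q
    using that var[of p q] mean[of p q] by (simp add: J_def)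
  \<comment> \<open>A nonintegrable function has Bochner integral 0 by convention, so the second
    moment being 1 forces square integrability.\<close>
  have sqint: "integrable M (\<lambda>\<omega>. (e p q \<omega>)\<^sup>2)" if "(p, q) \<in> J" for p q
    using sq1[OF that] not_integrable_integral_eq by fastforce
  have int: "integrable M (e p q)" if "(p, q) \<in> J" for p q
    using square_integrable_imp_integrable[OF rv[OF that] sqint[OF that]] .
  have uncor: "expectation (\<lambda>\<omega>. e p q \<omega> * e p' q' \<omega>) = 0"
    if "(p, q) \<in> J" "(p', q') \<in> J" "(p, q) \<noteq> (p', q')" for p q p' q'
  proof -
    let ?P = "{(p, q), (p', q')}"
    have "indep_vars (\<lambda>_. borel) (\<lambda>(k, l). e k l) ?P"
      using indep that by (auto intro: indep_vars_subset simp: J_def)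
    then have "expectation (\<lambda>\<omega>. \<Prod>x\<in>?P. (\<lambda>(k, l). e k l) x \<omega>) = (\<Prod>x\<in>?P. expectation ((\<lambda>(k, l). e k l) x))"
      by (rule indep_vars_lebesgue_integral[rotated]) (use that int in auto)
    then show ?thesis using that mean[of p q] by (auto simp: J_def)
  qed
  have "spatial_ar \<alpha> \<beta> \<gamma> e k l = (\<lambda>\<omega>. \<Sum>p\<in>I. (\<lambda>(i, j). green \<alpha> \<beta> \<gamma> i j) p * X p \<omega>)"
    by (simp add: fun_eq_iff spatial_ar_eq_sum_green I_def X_def sum.cartesian_product split_def)
  moreover have "variance (\<lambda>\<omega>. \<Sum>p\<in>I. (\<lambda>(i, j). green \<alpha> \<beta> \<gamma> i j) p * X p \<omega>)
      = (\<Sum>p\<in>I. ((\<lambda>(i, j). green \<alpha> \<beta> \<gamma> i j) p)\<^sup>2 * expectation (\<lambda>\<omega>. (X p \<omega>)\<^sup>2))"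
  proof (rule variance_sum_uncorrelated)
    show "expectation (\<lambda>\<omega>. X p \<omega> * X p' \<omega>) = 0" if pp: "p \<in> I" "p' \<in> I" "p \<noteq> p'" for p p'
    proof -
      obtain i j i' j' where [simp]: "p = (i, j)" "p' = (i', j')" by (metis surj_pair)
      \<comment> \<open>Truncated subtraction is injective here because \<open>i < k\<close> and
        \<open>j < l\<close> on \<open>I\<close>.\<close>
      have "(k - i, l - j) \<noteq> (k - i', l - j')" using pp by (auto simp: I_def)
      with pp show ?thesis using uncor[OF I_J I_J] by (simp add: X_def)
    qed
  qed (use I_J in \<open>auto simp: X_def I_def[symmetric] intro!: rv sqint\<close>,
       auto simp: I_def intro!: mean)
  moreover have "\<dots> = (\<Sum>p\<in>I. ((\<lambda>(i, j). green \<alpha> \<beta> \<gamma> i j) p)\<^sup>2)"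
    using I_J by (intro sum.cong) (auto simp: X_def sq1)
  ultimately show ?thesis
    unfolding green_energy_def I_def
    by (subst sum.swap) (simp add: sum.cartesian_product split_def)
qed

end

section \<open>Row sums as integrals over the circle\<close>

text \<open>Summing the recursion over \<open>i\<close> shows that passing from row \<open>j\<close>
  to row \<open>j + 1\<close> multiplies the generating function by (\<beta> + \<gamma> z) / (1 -
  \<alpha> z). Absolute convergence is carried along for the Cauchy product. The general field
  serves complex \<open>z\<close> for Parseval's identity and real \<open>z\<close> for the Chernoff
  bound.\<close>

lemma green_row_sums:
  fixes z :: "'a :: {real_normed_field, banach}"
  assumes z: "norm (of_real \<alpha> * z) < 1"
  shows "summable (\<lambda>i. norm (of_real (green \<alpha> \<beta> \<gamma> i j) * z ^ i)) \<and>
    (\<lambda>i. of_real (green \<alpha> \<beta> \<gamma> i j) * z ^ i) sums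
      ((of_real \<beta> + of_real \<gamma> * z) ^ j / (1 - of_real \<alpha> * z) ^ Suc j)"
proof (induction j)
  case 0
  have "(\<lambda>i. (of_real \<alpha> * z) ^ i) sums (1 / (1 - of_real \<alpha> * z))"
    using z by (rule geometric_sums)
  moreover have "summable (\<lambda>i. norm ((of_real \<alpha> * z) ^ i))"
    using z by (simp add: norm_power summable_geometric del: norm_mult)
  ultimately show ?case by (simp add: green_col_0 power_mult_distrib)
next
  case (Suc j)
  define a where "a = (\<lambda>i. of_real (green \<alpha> \<beta> \<gamma> i j) * z ^ i)"
  define b where "b = (\<lambda>i. of_real (green \<alpha> \<beta> \<gamma> i (Suc j)) * z ^ i)"
  define g where "g = (\<lambda>i. (of_real \<alpha> * z) ^ i)"
  \<comment> \<open>The terms of the series of row \<open>j\<close> multiplied by \<beta> + \<gamma>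
    z; the case distinction is the shift by one power of \<open>z\<close>.\<close>
  define h where "h = (\<lambda>i. of_real \<beta> * a i + (case i of 0 \<Rightarrow> 0 | Suc i \<Rightarrow> of_real \<gamma> * z * a i))"
  define w where "w = (of_real \<beta> + of_real \<gamma> * z) ^ j / (1 - of_real \<alpha> * z) ^ Suc j"
  have a: "summable (\<lambda>i. norm (a i))" "a sums w"
    using Suc by (simp_all add: a_def w_def)
  have g: "summable (\<lambda>i. norm (g i))" "g sums (1 / (1 - of_real \<alpha> * z))"
    using z by (simp_all add: g_def norm_power summable_geometric geometric_sums del: norm_mult)
  have "(\<lambda>i. case i of 0 \<Rightarrow> 0 | Suc i \<Rightarrow> of_real \<gamma> * z * a i) sums (of_real \<gamma> * z * w)"
    using sums_mult[OF a(2), of "of_real \<gamma> * z"]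
      sums_Suc[of "\<lambda>i. case i of 0 \<Rightarrow> 0 | Suc i \<Rightarrow> of_real \<gamma> * z * a i"] by simp
  from sums_add[OF sums_mult[OF a(2), of "of_real \<beta>"] this]
  have h_sums: "h sums ((of_real \<beta> + of_real \<gamma> * z) * w)"
    by (simp add: h_def algebra_simps)
  have "summable (\<lambda>i. case i of 0 \<Rightarrow> 0 | Suc i \<Rightarrow> norm (of_real \<gamma> * z) * norm (a i))"
    using summable_mult[OF a(1), of "norm (of_real \<gamma> * z)"]
      summable_Suc_iff[of "\<lambda>i. case i of 0 \<Rightarrow> 0 | Suc i \<Rightarrow> norm (of_real \<gamma> * z) * norm (a i)"] by simp
  from summable_add[OF summable_mult[OF a(1), of "norm (of_real \<beta> :: 'a)"] this]
  have h_summable: "summable (\<lambda>i. norm (h i))"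
    by (rule summable_comparison_test[rotated])
      (auto simp: h_def norm_mult split: nat.split intro!: exI[of _ 0] order_trans[OF norm_triangle_ineq])
  \<comment> \<open>The recursion reads b (i+1) = \<alpha> z b i + h (i+1); this first-order
    equation is solved by convolving \<open>h\<close> with the geometric sequence
    \<open>g\<close>.\<close>
  have b: "b = (\<lambda>i. \<Sum>k\<le>i. g k * h (i - k))"
  proof
    show "b i = (\<Sum>k\<le>i. g k * h (i - k))" for i
    proof (induction i)
      case (Suc i)
      have "b (Suc i) = of_real \<alpha> * z * b i + h (Suc i)"
        by (simp add: b_def h_def a_def algebra_simps)
      then show ?case
        unfolding Suc by (subst sum.atMost_Suc_shift) (simp add: g_def sum_distrib_left mult_ac)
    qed (simp add: b_def h_def a_def g_def)
  qed
  have "summable (\<lambda>i. \<Sum>k\<le>i. norm (g k) * norm (h (i - k)))"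
    using g(1) h_summable by (intro summable_Cauchy_product) auto
  then have "summable (\<lambda>i. norm (b i))"
    unfolding b by (rule summable_comparison_test[rotated])
      (auto intro!: exI[of _ 0] order_trans[OF norm_sum] sum_mono simp: norm_mult)
  moreover have "b sums ((\<Sum>i. g i) * (\<Sum>i. h i))"
    unfolding b using g(1) h_summable by (rule Cauchy_product_sums)
  then have "b sums ((1 / (1 - of_real \<alpha> * z)) * ((of_real \<beta> + of_real \<gamma> * z) * w))"
    using g(2) h_sums by (simp add: sums_iff)
  ultimately show ?case
    by (simp add: b_def w_def divide_simps mult_ac)
qed

section \<open>Orthogonality of exponentials and Parseval's identity\<close>

abbreviation circ :: "real measure" where
  "circ \<equiv> restrict_space lborel {- pi..pi}"

lemma finite_measure_circ: "finite_measure circ"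
  by (rule finite_measureI) (simp add: emeasure_restrict_space space_restrict_space)

lemma integral_circ:
  fixes f :: "real \<Rightarrow> 'a :: {banach, second_countable_topology}"
  shows "(LINT \<theta>|circ. f \<theta>) = (LINT \<theta>|lborel. indicator {- pi..pi} \<theta> *\<^sub>R f \<theta>)"
  by (simp add: integral_restrict_space)

lemma integrable_circ_continuous:
  fixes f :: "real \<Rightarrow> 'a :: {banach, second_countable_topology}"
  assumes "continuous_on {- pi..pi} f"
  shows "integrable circ f"
  using borel_integrable_atLeastAtMost'[OF assms]
  by (simp add: integrable_restrict_space set_integrable_def)

lemma integral_cis_power_orthogonal:
  "(LINT \<theta>|circ. cis \<theta> ^ m * cnj (cis \<theta> ^ n)) = (if m = n then 2 * pi else 0)"
proof -
  define c where "c = real m - real n"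
  have eq: "cis \<theta> ^ m * cnj (cis \<theta> ^ n) = cis (c * \<theta>)" for \<theta>
  proof -
    have "real m * \<theta> + - (real n * \<theta>) = c * \<theta>" by (simp add: c_def algebra_simps)
    then show ?thesis by (simp only: Complex.DeMoivre cis_cnj cis_mult)
  qed
  show ?thesis
  proof (cases "m = n")
    case True
    then show ?thesis unfolding eq integral_circ by (simp add: c_def scaleR_conv_of_real)
  next
    case False
    then have "c \<noteq> 0" by (simp add: c_def)
    have "(LINT \<theta>|lborel. indicator {- pi..pi} \<theta> *\<^sub>R cis (c * \<theta>))
        = cis (c * pi) / (\<i> * c) - cis (c * (- pi)) / (\<i> * c)"
    proof (rule integral_FTC_atLeastAtMost)
      show "((\<lambda>\<theta>. cis (c * \<theta>) / (\<i> * c)) has_vector_derivative cis (c * x)) (at x within {- pi..pi})" for x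
      proof -
        have "((\<lambda>z. exp (\<i> * c * z) / (\<i> * c)) has_field_derivative exp (\<i> * c * of_real x)) (at (of_real x))"
          using \<open>c \<noteq> 0\<close> by (auto intro!: derivative_eq_intros)
        from has_vector_derivative_real_field[OF this]
        show ?thesis by (simp add: cis_conv_exp mult.assoc)
      qed
    qed (auto intro!: continuous_intros)
    also have "\<dots> = 0"
    proof -
      have "c = of_int (int m - int n)" by (simp add: c_def)
      then have "sin (c * pi) = 0" by (metis mult.commute sin_npi_int)
      then have "cis (c * pi) = cis (c * (- pi))" by (simp add: complex_eq_iff)
      then show ?thesis by (simp only: diff_self)
    qed
    finally show ?thesis using False unfolding eq integral_circ by simp
  qed
qed

text \<open>Absolute summability permits termwise integration twice: first to read off the Fourier
  coefficients of \<open>F\<close>, then to integrate |F|^2 = F * cnj F with the second factor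
  expanded in its series.\<close>

lemma parseval:
  fixes a :: "nat \<Rightarrow> real"
  assumes a: "summable (\<lambda>i. \<bar>a i\<bar>)"
    and F: "\<And>\<theta>. (\<lambda>i. of_real (a i) * cis \<theta> ^ i) sums F \<theta>"
  shows "(\<lambda>i. (a i)\<^sup>2) sums (1 / (2 * pi) * (LINT \<theta>|circ. (cmod (F \<theta>))\<^sup>2))"
proof -
  interpret finite_measure circ by (rule finite_measure_circ)
  define S where "S = (\<Sum>i. \<bar>a i\<bar>)"
  have bnd: "cmod (F \<theta>) \<le> S" for \<theta>
  proof -
    have "norm (\<Sum>i. of_real (a i) * cis \<theta> ^ i) \<le> (\<Sum>i. norm (of_real (a i) * cis \<theta> ^ i))"
      using a by (intro summable_norm) (simp add: norm_mult norm_power)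
    then show ?thesis using F[of \<theta>] by (simp add: S_def sums_iff norm_mult norm_power)
  qed
  have "F = (\<lambda>\<theta>. \<Sum>i. of_real (a i) * cis \<theta> ^ i)"
    using F by (simp add: fun_eq_iff sums_iff)
  moreover have cis_meas: "(\<lambda>\<theta>. cis \<theta> ^ i) \<in> borel_measurable lborel" for i
    by (simp, intro borel_measurable_continuous_onI continuous_intros)
  ultimately have "F \<in> borel_measurable lborel" by simp
  then have F_meas [measurable]: "F \<in> borel_measurable circ" by (rule measurable_restrict_space1)
  have cis_meas' [measurable]: "(\<lambda>\<theta>. cis \<theta> ^ i) \<in> borel_measurable circ" for i
    by (rule measurable_restrict_space1[OF cis_meas])
  have [measurable]: "(\<lambda>\<theta>. cnj (cis \<theta>) ^ i) \<in> borel_measurable circ" for i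
    by (rule measurable_restrict_space1, simp, intro borel_measurable_continuous_onI continuous_intros)
  have int_cis: "integrable circ (\<lambda>\<theta>. cis \<theta> ^ i * cnj (cis \<theta> ^ m))" for i m
    by (intro integrable_circ_continuous continuous_intros)
  have coeff: "(LINT \<theta>|circ. F \<theta> * cnj (cis \<theta> ^ m)) = 2 * pi * a m" for m
  proof -
    have "(\<lambda>i. LINT \<theta>|circ. of_real (a i) * (cis \<theta> ^ i * cnj (cis \<theta> ^ m)))
        sums (LINT \<theta>|circ. (\<Sum>i. of_real (a i) * (cis \<theta> ^ i * cnj (cis \<theta> ^ m))))"
    proof (rule sums_integral)
      show "AE \<theta> in circ. summable (\<lambda>i. norm (of_real (a i) * (cis \<theta> ^ i * cnj (cis \<theta> ^ m))))"
        using a by (simp add: norm_mult norm_power)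
      show "summable (\<lambda>i. LINT \<theta>|circ. norm (of_real (a i) * (cis \<theta> ^ i * cnj (cis \<theta> ^ m))))"
        using a by (simp add: norm_mult norm_power summable_mult2)
    qed (use int_cis in auto)
    moreover have "(\<Sum>i. of_real (a i) * (cis \<theta> ^ i * cnj (cis \<theta> ^ m))) = F \<theta> * cnj (cis \<theta> ^ m)" for \<theta>
      using sums_mult2[OF F[of \<theta>], of "cnj (cis \<theta> ^ m)"] by (simp add: sums_iff mult.assoc)
    moreover have "(\<lambda>i. LINT \<theta>|circ. of_real (a i) * (cis \<theta> ^ i * cnj (cis \<theta> ^ m)))
        = (\<lambda>i. if i = m then 2 * pi * complex_of_real (a m) else 0)"
      by (subst integral_mult_right_zero) (auto simp del: complex_cnj_power simp: integral_cis_power_orthogonal fun_eq_iff)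
    ultimately have "(\<lambda>i. if i = m then 2 * pi * complex_of_real (a m) else 0) sums (LINT \<theta>|circ. F \<theta> * cnj (cis \<theta> ^ m))"
      by (simp only:)
    from sums_unique2[OF this sums_single[of m "\<lambda>_. 2 * pi * complex_of_real (a m)"]]
    show ?thesis by simp
  qed
  have intF: "integrable circ (\<lambda>\<theta>. F \<theta> * cnj (cis \<theta> ^ m))" for m
    by (rule integrable_const_bound[where B=S]) (auto simp: norm_mult norm_power bnd)
  have "(\<lambda>m. LINT \<theta>|circ. of_real (a m) * (F \<theta> * cnj (cis \<theta> ^ m)))
        sums (LINT \<theta>|circ. (\<Sum>m. of_real (a m) * (F \<theta> * cnj (cis \<theta> ^ m))))"
  proof (rule sums_integral)
    show "AE \<theta> in circ. summable (\<lambda>i. norm (of_real (a i) * (F \<theta> * cnj (cis \<theta> ^ i))))"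
      using a by (auto simp: norm_mult norm_power summable_mult2)
    show "summable (\<lambda>i. LINT \<theta>|circ. norm (of_real (a i) * (F \<theta> * cnj (cis \<theta> ^ i))))"
      using a by (simp add: norm_mult norm_power summable_mult2)
  qed (use intF in auto)
  moreover have "(\<Sum>m. of_real (a m) * (F \<theta> * cnj (cis \<theta> ^ m))) = of_real ((cmod (F \<theta>))\<^sup>2)" for \<theta>
  proof -
    have "(\<lambda>m. cnj (of_real (a m) * cis \<theta> ^ m)) sums cnj (F \<theta>)"
      using F[of \<theta>] by (simp only: sums_cnj)
    from sums_mult[OF this, of "F \<theta>"]
    have "(\<Sum>m. of_real (a m) * (F \<theta> * cnj (cis \<theta> ^ m))) = F \<theta> * cnj (F \<theta>)"
      by (simp add: sums_iff mult_ac)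
    then show ?thesis by (simp only: complex_norm_square)
  qed
  moreover have "(LINT \<theta>|circ. of_real (a m) * (F \<theta> * cnj (cis \<theta> ^ m))) = of_real (2 * pi * (a m)\<^sup>2)" for m
    by (subst integral_mult_right_zero) (simp del: complex_cnj_power add: coeff power2_eq_square)
  ultimately have "(\<lambda>m. complex_of_real (2 * pi * (a m)\<^sup>2)) sums of_real (LINT \<theta>|circ. (cmod (F \<theta>))\<^sup>2)"
    by (simp only: integral_complex_of_real)
  then have "(\<lambda>m. 2 * pi * (a m)\<^sup>2) sums (LINT \<theta>|circ. (cmod (F \<theta>))\<^sup>2)"
    by (simp only: sums_of_real_iff)
  from sums_mult[OF this, of "1 / (2 * pi)"]
  show "(\<lambda>i. (a i)\<^sup>2) sums (1 / (2 * pi) * (LINT \<theta>|circ. (cmod (F \<theta>))\<^sup>2))" by simp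
qed

definition row_energy :: "real \<Rightarrow> real \<Rightarrow> real \<Rightarrow> nat \<Rightarrow> real" where
  "row_energy \<alpha> \<beta> \<gamma> j = (\<Sum>i. (green \<alpha> \<beta> \<gamma> i j)\<^sup>2)"

text \<open>Since |\<alpha>| < 1, the unit circle lies inside the disc of convergence of the row
  generating function. The two trigonometric expressions are the squared moduli of \<beta> +
  \<gamma> z and 1 - \<alpha> z at z = \<open>cis \<theta>\<close>.\<close>

lemma row_energy_integral:
  assumes "\<bar>\<alpha>\<bar> < 1"
  shows "(\<lambda>i. (green \<alpha> \<beta> \<gamma> i j)\<^sup>2) sums row_energy \<alpha> \<beta> \<gamma> j" (is ?sums)
    and "row_energy \<alpha> \<beta> \<gamma> j = 1 / (2 * pi) * (LINT \<theta>|circ.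
      (\<beta>\<^sup>2 + \<gamma>\<^sup>2 + 2 * \<beta> * \<gamma> * cos \<theta>) ^ j / (1 + \<alpha>\<^sup>2 - 2 * \<alpha> * cos \<theta>) ^ Suc j)" (is ?eq)
proof -
  define F where "F = (\<lambda>\<theta>. (of_real \<beta> + of_real \<gamma> * cis \<theta>) ^ j / (1 - of_real \<alpha> * cis \<theta>) ^ Suc j)"
  have *: "norm (of_real \<alpha> * cis \<theta>) < 1" for \<theta> using assms by (simp add: norm_mult)
  have "summable (\<lambda>i. \<bar>green \<alpha> \<beta> \<gamma> i j\<bar>)"
    using green_row_sums[OF *[of 0], of \<beta> \<gamma> j] by simp
  moreover have "(\<lambda>i. of_real (green \<alpha> \<beta> \<gamma> i j) * cis \<theta> ^ i) sums F \<theta>" for \<theta>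
    unfolding F_def using green_row_sums[OF *[of \<theta>], of \<beta> \<gamma> j] by blast
  ultimately have "(\<lambda>i. (green \<alpha> \<beta> \<gamma> i j)\<^sup>2) sums (1 / (2 * pi) * (LINT \<theta>|circ. (cmod (F \<theta>))\<^sup>2))"
    by (rule parseval)
  moreover have "(cmod (F \<theta>))\<^sup>2 = (\<beta>\<^sup>2 + \<gamma>\<^sup>2 + 2 * \<beta> * \<gamma> * cos \<theta>) ^ j / (1 + \<alpha>\<^sup>2 - 2 * \<alpha> * cos \<theta>) ^ Suc j" for \<theta>
  proof -
    have "(cmod (of_real \<beta> + of_real \<gamma> * cis \<theta>))\<^sup>2 = (\<beta> + \<gamma> * cos \<theta>)\<^sup>2 + (\<gamma> * sin \<theta>)\<^sup>2"
      unfolding cmod_power2 by simp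
    also have "\<dots> = \<beta>\<^sup>2 + \<gamma>\<^sup>2 + 2 * \<beta> * \<gamma> * cos \<theta>"
      using sin_cos_squared_add[of \<theta>] by algebra
    finally have "(cmod (of_real \<beta> + of_real \<gamma> * cis \<theta>))\<^sup>2 = \<beta>\<^sup>2 + \<gamma>\<^sup>2 + 2 * \<beta> * \<gamma> * cos \<theta>" .
    moreover have "(cmod (1 - of_real \<alpha> * cis \<theta>))\<^sup>2 = (1 - \<alpha> * cos \<theta>)\<^sup>2 + (\<alpha> * sin \<theta>)\<^sup>2"
      unfolding cmod_power2 by simp
    moreover have "\<dots> = 1 + \<alpha>\<^sup>2 - 2 * \<alpha> * cos \<theta>"
      using sin_cos_squared_add[of \<theta>] by algebra
    ultimately show ?thesis
      unfolding F_def norm_divide norm_power power_divide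
      by (simp only: power_mult[symmetric] mult.commute[of _ 2]) (simp only: power_mult)
  qed
  ultimately show ?sums ?eq
    by (simp_all add: row_energy_def sums_iff)
qed

text \<open>The expression is the squared modulus of 1 - \<alpha> z on the unit circle; the bound
  uniform in \<theta> feeds the dominating functions below.\<close>

lemma row_denominator_pos:
  fixes \<alpha> :: real
  assumes "\<bar>\<alpha>\<bar> < 1"
  shows "(1 - \<bar>\<alpha>\<bar>)\<^sup>2 \<le> 1 + \<alpha>\<^sup>2 - 2 * \<alpha> * cos \<theta>" "0 < 1 + \<alpha>\<^sup>2 - 2 * \<alpha> * cos \<theta>"
proof -
  have "\<bar>\<alpha> * cos \<theta>\<bar> \<le> \<bar>\<alpha>\<bar>" by (simp add: abs_mult mult_left_le)
  then show *: "(1 - \<bar>\<alpha>\<bar>)\<^sup>2 \<le> 1 + \<alpha>\<^sup>2 - 2 * \<alpha> * cos \<theta>" by (simp add: power2_diff)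
  have "0 < (1 - \<bar>\<alpha>\<bar>)\<^sup>2" using assms by simp
  with * show "0 < 1 + \<alpha>\<^sup>2 - 2 * \<alpha> * cos \<theta>" by linarith
qed

section \<open>The stable regime\<close>

lemma sum_green_sq_le_row_energy:
  assumes "\<bar>\<alpha>\<bar> < 1"
  shows "(\<Sum>i<k. (green \<alpha> \<beta> \<gamma> i j)\<^sup>2) \<le> row_energy \<alpha> \<beta> \<gamma> j"
  using row_energy_integral(1)[OF assms, of \<beta> \<gamma> j]
  by (auto simp: row_energy_def sums_iff intro!: sum_le_suminf)

lemma green_energy_mono:
  assumes "k \<le> k'" "l \<le> l'"
  shows "green_energy \<alpha> \<beta> \<gamma> k l \<le> green_energy \<alpha> \<beta> \<gamma> k' l'"
proof -
  have "green_energy \<alpha> \<beta> \<gamma> k l \<le> green_energy \<alpha> \<beta> \<gamma> k' l"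
    unfolding green_energy_def using assms by (intro sum_mono sum_mono2) auto
  also have "\<dots> \<le> green_energy \<alpha> \<beta> \<gamma> k' l'"
    unfolding green_energy_def using assms by (intro sum_mono2) (auto intro: sum_nonneg)
  finally show ?thesis .
qed

text \<open>Monotonicity lets \<open>k\<close> and \<open>l\<close> diverge at unrelated rates: from
  below, finitely many rows already come close to \<open>S\<close> and each is exhausted as
  \<open>k\<close> grows; from above, every partial sum is at most \<open>S\<close>.\<close>

lemma green_energy_tendsto_total:
  assumes \<alpha>: "\<bar>\<alpha>\<bar> < 1"
    and S: "row_energy \<alpha> \<beta> \<gamma> sums S"
    and k: "filterlim k at_top F" and l: "filterlim l at_top F"
  shows "((\<lambda>n. green_energy \<alpha> \<beta> \<gamma> (k n) (l n)) \<longlongrightarrow> S) F"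
proof (rule order_tendstoI)
  fix a assume "a < S"
  then have "eventually (\<lambda>L. a < (\<Sum>j<L. row_energy \<alpha> \<beta> \<gamma> j)) sequentially"
    using S by (simp add: sums_def order_tendsto_iff)
  then obtain L where L: "a < (\<Sum>j<L. row_energy \<alpha> \<beta> \<gamma> j)"
    using eventually_happens by fastforce
  have "(\<lambda>K. green_energy \<alpha> \<beta> \<gamma> K L) \<longlonglongrightarrow> (\<Sum>j<L. row_energy \<alpha> \<beta> \<gamma> j)"
    unfolding green_energy_def
    by (intro tendsto_sum row_energy_integral(1)[OF \<alpha>, unfolded sums_def])
  then have "((\<lambda>n. green_energy \<alpha> \<beta> \<gamma> (k n) L) \<longlongrightarrow> (\<Sum>j<L. row_energy \<alpha> \<beta> \<gamma> j)) F"
    by (rule filterlim_compose[OF _ k])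
  with L have "\<forall>\<^sub>F n in F. a < green_energy \<alpha> \<beta> \<gamma> (k n) L"
    by (simp add: order_tendsto_iff)
  moreover have "\<forall>\<^sub>F n in F. L \<le> l n"
    using l by (simp add: filterlim_at_top)
  ultimately show "\<forall>\<^sub>F n in F. a < green_energy \<alpha> \<beta> \<gamma> (k n) (l n)"
    by eventually_elim (meson green_energy_mono order.refl order_less_le_trans)
next
  fix a assume "S < a"
  have "row_energy \<alpha> \<beta> \<gamma> j \<ge> 0" for j
    using sum_green_sq_le_row_energy[OF \<alpha>, where k=0] by simp
  then have "(\<Sum>j<L. row_energy \<alpha> \<beta> \<gamma> j) \<le> S" for L
    using S sum_le_suminf[of "row_energy \<alpha> \<beta> \<gamma>" "{..<L}"] by (simp add: sums_iff)
  then have "green_energy \<alpha> \<beta> \<gamma> (k n) (l n) \<le> S" for n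
    unfolding green_energy_def by (rule order_trans[OF sum_mono[OF sum_green_sq_le_row_energy[OF \<alpha>]]])
  with \<open>S < a\<close> show "\<forall>\<^sub>F n in F. green_energy \<alpha> \<beta> \<gamma> (k n) (l n) < a"
    by (intro always_eventually allI) (rule le_less_trans)
qed

text \<open>After factoring the denominator as c (1 + r^2 - 2 r cos \<theta>) with |r| < 1, this is
  Parseval's identity for the geometric sequence r^i, obtained as row 0 of the Green function with
  parameters \<open>r\<close>, 0, 0.\<close>

lemma poisson_integral:
  fixes A u :: real
  assumes "2 * \<bar>u\<bar> < A"
  shows "(LINT \<theta>|circ. 1 / (A - 2 * u * cos \<theta>)) = 2 * pi / sqrt (A\<^sup>2 - 4 * u\<^sup>2)"
proof -
  define w where "w = sqrt (A\<^sup>2 - 4 * u\<^sup>2)"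
  \<comment> \<open>The larger root of c^2 - A c + u^2 = 0, which makes A = c (1 + r^2) and keeps r
    = u / c inside the unit interval.\<close>
  define c where "c = (A + w) / 2"
  define r where "r = u / c"
  have "(2 * \<bar>u\<bar>)\<^sup>2 < A\<^sup>2" using assms by (intro power_strict_mono) auto
  then have pos: "0 < A\<^sup>2 - 4 * u\<^sup>2" by simp
  then have w: "0 < w" "w\<^sup>2 = A\<^sup>2 - 4 * u\<^sup>2" by (simp_all add: w_def)
  have c: "0 < c" "\<bar>u\<bar> < c" using w(1) assms by (auto simp: c_def)
  then have r: "\<bar>r\<bar> < 1" "u = c * r" by (simp_all add: r_def)
  have "c * c + u * u = A * c"
    using w(2) by (simp add: c_def power2_eq_square field_simps)
  then have "c * (c * (1 + r\<^sup>2)) = c * A"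
    by (simp add: r(2) power2_eq_square algebra_simps)
  then have A: "A = c * (1 + r\<^sup>2)" using c by simp
  have "w = 2 * c - A" unfolding c_def by (simp add: field_simps)
  also have "\<dots> = c * (1 - r\<^sup>2)" unfolding A by (simp add: algebra_simps)
  finally have w_eq: "w = c * (1 - r\<^sup>2)" .
  have "(\<lambda>i. (r\<^sup>2) ^ i) sums (1 / (1 - r\<^sup>2))"
    using r(1) by (intro geometric_sums) (simp add: abs_square_less_1)
  then have "(\<lambda>i. (green r 0 0 i 0)\<^sup>2) sums (1 / (1 - r\<^sup>2))"
    by (simp add: green_col_0 power_mult[symmetric] mult.commute)
  then have "row_energy r 0 0 0 = 1 / (1 - r\<^sup>2)"
    by (simp add: row_energy_def sums_iff)
  then have *: "(LINT \<theta>|circ. 1 / (1 + r\<^sup>2 - 2 * r * cos \<theta>)) = 2 * pi / (1 - r\<^sup>2)"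
    using row_energy_integral(2)[OF r(1), of 0 0 0] by (simp add: field_simps)
  have "(LINT \<theta>|circ. 1 / (A - 2 * u * cos \<theta>)) = (LINT \<theta>|circ. 1 / c * (1 / (1 + r\<^sup>2 - 2 * r * cos \<theta>)))"
    unfolding A r(2) by (simp add: algebra_simps)
  also have "\<dots> = 1 / c * (2 * pi / (1 - r\<^sup>2))"
    unfolding * [symmetric] by (rule integral_mult_right_zero)
  also have "\<dots> = 2 * pi / w" by (simp add: w_eq)
  finally show ?thesis by (simp add: w_def)
qed

text \<open>The integrand of row \<open>j\<close> is (p/d)^j / d. The hypothesis keeps p/d uniformly
  below 1, so the geometric series may be summed under the integral; its sum 1 / (d - p) is of the
  form treated in \<open>poisson_integral\<close>.\<close>

lemma row_energy_sums_total:
  assumes \<alpha>: "\<bar>\<alpha>\<bar> < 1"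
    and u: "2 * \<bar>\<alpha> + \<beta> * \<gamma>\<bar> < 1 + \<alpha>\<^sup>2 - \<beta>\<^sup>2 - \<gamma>\<^sup>2"
  shows "row_energy \<alpha> \<beta> \<gamma> sums
    (1 / sqrt ((1 + \<alpha>\<^sup>2 - \<beta>\<^sup>2 - \<gamma>\<^sup>2)\<^sup>2 - 4 * (\<alpha> + \<beta> * \<gamma>)\<^sup>2))"
proof -
  interpret finite_measure circ by (rule finite_measure_circ)
  define A where "A = 1 + \<alpha>\<^sup>2 - \<beta>\<^sup>2 - \<gamma>\<^sup>2"
  define v where "v = \<alpha> + \<beta> * \<gamma>"
  define d where "d = (\<lambda>\<theta>. 1 + \<alpha>\<^sup>2 - 2 * \<alpha> * cos \<theta>)"
  define p where "p = (\<lambda>\<theta>. \<beta>\<^sup>2 + \<gamma>\<^sup>2 + 2 * \<beta> * \<gamma> * cos \<theta>)"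
  \<comment> \<open>From d - p \<ge> A - 2|v| and d \<le> 4 one gets p/d \<le> q.\<close>
  define q where "q = 1 - (A - 2 * \<bar>v\<bar>) / 4"
  have d_pos: "0 < d \<theta>" and d_ge: "(1 - \<bar>\<alpha>\<bar>)\<^sup>2 \<le> d \<theta>" for \<theta>
    using row_denominator_pos[OF \<alpha>, of \<theta>] by (simp_all add: d_def)
  have d_minus_p: "d \<theta> - p \<theta> = A - 2 * v * cos \<theta>" for \<theta>
    by (simp add: d_def p_def A_def v_def algebra_simps)
  have cos_le: "\<bar>x * cos \<theta>\<bar> \<le> \<bar>x\<bar>" for x \<theta> :: real
    by (simp add: abs_mult mult_left_le)
  have d_le: "d \<theta> \<le> 4" for \<theta>
    using cos_le[of \<alpha> \<theta>] \<alpha> abs_square_less_1[of \<alpha>] by (simp add: d_def)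
  have p_nonneg: "0 \<le> p \<theta>" for \<theta>
  proof -
    have "p \<theta> = (\<beta> + \<gamma> * cos \<theta>)\<^sup>2 + (\<gamma> * sin \<theta>)\<^sup>2"
      using sin_cos_squared_add[of \<theta>] unfolding p_def by algebra
    then show ?thesis by simp
  qed
  have p_le: "p \<theta> \<le> q * d \<theta>" for \<theta>
  proof -
    define m where "m = A - 2 * \<bar>v\<bar>"
    have "0 \<le> m" using u by (simp add: m_def A_def v_def)
    then have "m * d \<theta> \<le> m * 4"
      using d_le by (intro mult_left_mono)
    moreover have "m \<le> d \<theta> - p \<theta>"
      using cos_le[of v \<theta>] by (simp add: m_def d_minus_p)
    ultimately show ?thesis by (simp add: q_def m_def[symmetric] left_diff_distrib)
  qed
  have q: "0 \<le> q" "q < 1"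
  proof -
    show "0 \<le> q"
      using order_trans[OF p_nonneg[of 0] p_le[of 0]] d_pos[of 0] by (meson mult_neg_pos not_less)
    show "q < 1" using u by (simp add: q_def A_def v_def)
  qed
  have integ: "integrable circ (\<lambda>\<theta>. p \<theta> ^ j / d \<theta> ^ Suc j)" for j
  proof -
    have "d \<theta> \<noteq> 0" for \<theta> using d_pos[of \<theta>] by simp
    moreover have "continuous_on {- pi..pi} p" "continuous_on {- pi..pi} d"
      unfolding p_def d_def by (auto intro!: continuous_intros)
    ultimately show ?thesis
      by (intro integrable_circ_continuous continuous_on_divide continuous_on_power) auto
  qed
  have bound: "norm (p \<theta> ^ j / d \<theta> ^ Suc j) \<le> q ^ j / (1 - \<bar>\<alpha>\<bar>)\<^sup>2" for \<theta> j
  proof -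
    have "norm (p \<theta> ^ j / d \<theta> ^ Suc j) = (p \<theta> / d \<theta>) ^ j * (1 / d \<theta>)"
      using p_nonneg[of \<theta>] d_pos[of \<theta>] by (simp add: power_divide)
    also have "\<dots> \<le> q ^ j * (1 / (1 - \<bar>\<alpha>\<bar>)\<^sup>2)"
      using p_nonneg[of \<theta>] d_pos[of \<theta>] p_le[of \<theta>] d_ge[of \<theta>] \<alpha> q
      by (intro mult_mono power_mono divide_left_mono) (auto simp: pos_divide_le_eq)
    finally show ?thesis by simp
  qed
  have geo: "(\<lambda>j. p \<theta> ^ j / d \<theta> ^ Suc j) sums (1 / (A - 2 * v * cos \<theta>))" for \<theta>
  proof -
    have "norm (p \<theta> / d \<theta>) < 1"
      using p_nonneg[of \<theta>] d_pos[of \<theta>] p_le[of \<theta>] q mult_strict_right_mono[OF q(2) d_pos[of \<theta>]] by simp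
    from sums_mult2[OF geometric_sums[OF this], of "1 / d \<theta>"]
    show ?thesis using d_pos[of \<theta>] unfolding d_minus_p[symmetric]
      by (simp add: power_divide divide_simps mult_ac split: if_splits)
  qed
  have "(\<lambda>j. LINT \<theta>|circ. p \<theta> ^ j / d \<theta> ^ Suc j) sums (LINT \<theta>|circ. (\<Sum>j. p \<theta> ^ j / d \<theta> ^ Suc j))"
  proof (rule sums_integral)
    have qs: "summable (\<lambda>j. q ^ j / (1 - \<bar>\<alpha>\<bar>)\<^sup>2)"
      using q by (intro summable_divide summable_geometric) simp
    show "AE \<theta> in circ. summable (\<lambda>j. norm (p \<theta> ^ j / d \<theta> ^ Suc j))"
    proof (intro AE_I2 summable_comparison_test'[OF qs, of 0])
      show "norm (norm (p \<theta> ^ j / d \<theta> ^ Suc j)) \<le> q ^ j / (1 - \<bar>\<alpha>\<bar>)\<^sup>2" for \<theta> j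
        using bound[of \<theta> j] by (simp only: real_norm_def abs_abs)
    qed
    show "summable (\<lambda>j. LINT \<theta>|circ. norm (p \<theta> ^ j / d \<theta> ^ Suc j))"
    proof (rule summable_comparison_test'[of _ 0])
      show "summable (\<lambda>j. q ^ j / (1 - \<bar>\<alpha>\<bar>)\<^sup>2 * measure circ (space circ))"
        by (rule summable_mult2[OF qs])
      show "norm (LINT \<theta>|circ. norm (p \<theta> ^ j / d \<theta> ^ Suc j)) \<le> q ^ j / (1 - \<bar>\<alpha>\<bar>)\<^sup>2 * measure circ (space circ)" for j
      proof -
        have "norm (LINT \<theta>|circ. norm (p \<theta> ^ j / d \<theta> ^ Suc j)) = (LINT \<theta>|circ. norm (p \<theta> ^ j / d \<theta> ^ Suc j))"
          by simp
        also have "\<dots> \<le> (LINT \<theta>|circ. q ^ j / (1 - \<bar>\<alpha>\<bar>)\<^sup>2)"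
          using bound by (intro integral_mono integrable_norm integ) auto
        finally show ?thesis by (simp add: mult.commute)
      qed
    qed
  qed (rule integ)
  also have "(LINT \<theta>|circ. (\<Sum>j. p \<theta> ^ j / d \<theta> ^ Suc j)) = 2 * pi / sqrt (A\<^sup>2 - 4 * v\<^sup>2)"
  proof -
    have "(\<Sum>j. p \<theta> ^ j / d \<theta> ^ Suc j) = 1 / (A - 2 * v * cos \<theta>)" for \<theta>
      using geo[of \<theta>] by (simp only: sums_iff)
    moreover have "2 * \<bar>v\<bar> < A" using u by (simp only: A_def v_def)
    ultimately show ?thesis by (simp only: poisson_integral)
  qed
  finally have "(\<lambda>j. 1 / (2 * pi) * (LINT \<theta>|circ. p \<theta> ^ j / d \<theta> ^ Suc j))
      sums (1 / (2 * pi) * (2 * pi / sqrt (A\<^sup>2 - 4 * v\<^sup>2)))"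
    by (rule sums_mult)
  moreover have "row_energy \<alpha> \<beta> \<gamma> = (\<lambda>j. 1 / (2 * pi) * (LINT \<theta>|circ. p \<theta> ^ j / d \<theta> ^ Suc j))"
    unfolding p_def d_def by (rule ext) (rule row_energy_integral(2)[OF \<alpha>])
  ultimately show ?thesis
    by (simp add: A_def v_def)
qed

text \<open>With A = 1 + \<alpha>^2 - \<beta>^2 - \<gamma>^2 and v = \<alpha> + \<beta> \<gamma>,
  the outer factors multiply as A - 2v = (1 - \<alpha>)^2 - (\<beta> + \<gamma>)^2 and A + 2v = (1 +
  \<alpha>)^2 - (\<beta> - \<gamma>)^2. Nonnegativity of the base turns \<open>powr\<close> into a
  square root.\<close>

lemma stationary_variance_eq:
  assumes "2 * \<bar>\<alpha> + \<beta> * \<gamma>\<bar> < 1 + \<alpha>\<^sup>2 - \<beta>\<^sup>2 - \<gamma>\<^sup>2"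
  shows "stationary_variance \<alpha> \<beta> \<gamma> = 1 / sqrt ((1 + \<alpha>\<^sup>2 - \<beta>\<^sup>2 - \<gamma>\<^sup>2)\<^sup>2 - 4 * (\<alpha> + \<beta> * \<gamma>)\<^sup>2)"
proof -
  have "(1 + \<alpha> + \<beta> - \<gamma>) * (1 + \<alpha> - \<beta> + \<gamma>) * (1 - \<alpha> + \<beta> + \<gamma>) * (1 - \<alpha> - \<beta> - \<gamma>)
      = (1 + \<alpha>\<^sup>2 - \<beta>\<^sup>2 - \<gamma>\<^sup>2)\<^sup>2 - 4 * (\<alpha> + \<beta> * \<gamma>)\<^sup>2" (is "?P = ?Q")
    by (simp add: power2_eq_square algebra_simps)
  moreover have "(2 * \<bar>\<alpha> + \<beta> * \<gamma>\<bar>)\<^sup>2 \<le> (1 + \<alpha>\<^sup>2 - \<beta>\<^sup>2 - \<gamma>\<^sup>2)\<^sup>2"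
    using assms by (intro power_mono) auto
  then have "0 \<le> ?Q" by simp
  ultimately show ?thesis
    by (simp add: stationary_variance_def powr_minus powr_half_sqrt inverse_eq_divide)
qed

text \<open>The hypotheses of case (i) exclude the negative sign of the quantity inside the absolute
  value: with \<open>u = \<alpha> + \<beta> * \<gamma>\<close> it equals \<open>(1 - \<beta>\<^sup>2) * (1 - \<gamma>\<^sup>2) + u\<^sup>2 - 2 * u * \<beta> * \<gamma>\<close>.\<close>

lemma stable_regime:
  fixes \<alpha> \<beta> \<gamma> :: real
  assumes "\<bar>\<beta>\<bar> < 1" "\<bar>\<gamma>\<bar> < 1"
    and abs: "\<bar>1 + \<alpha>\<^sup>2 - \<beta>\<^sup>2 - \<gamma>\<^sup>2\<bar> > 2 * \<bar>\<alpha> + \<beta> * \<gamma>\<bar>"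
  shows "1 + \<alpha>\<^sup>2 - \<beta>\<^sup>2 - \<gamma>\<^sup>2 > 2 * \<bar>\<alpha> + \<beta> * \<gamma>\<bar>"
proof -
  define u where "u = \<alpha> + \<beta> * \<gamma>"
  have "1 + \<alpha>\<^sup>2 - \<beta>\<^sup>2 - \<gamma>\<^sup>2 = (1 - \<beta>\<^sup>2) * (1 - \<gamma>\<^sup>2) + u\<^sup>2 - 2 * (u * (\<beta> * \<gamma>))"
    by (simp add: u_def power2_eq_square algebra_simps)
  moreover have "0 \<le> (1 - \<beta>\<^sup>2) * (1 - \<gamma>\<^sup>2)"
    using assms by (intro mult_nonneg_nonneg) (simp_all add: abs_square_le_1)
  moreover have "\<bar>u * (\<beta> * \<gamma>)\<bar> \<le> \<bar>u\<bar>"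
    using assms by (auto simp: abs_mult intro!: mult_left_le mult_le_one)
  moreover have "0 \<le> u\<^sup>2" by simp
  ultimately have "1 + \<alpha>\<^sup>2 - \<beta>\<^sup>2 - \<gamma>\<^sup>2 \<ge> - 2 * \<bar>u\<bar>" by linarith
  with abs show ?thesis unfolding u_def by linarith
qed

lemma green_energy_stable:
  assumes "\<bar>\<alpha>\<bar> < 1" "\<bar>\<beta>\<bar> < 1" "\<bar>\<gamma>\<bar> < 1"
    and "\<bar>1 + \<alpha>\<^sup>2 - \<beta>\<^sup>2 - \<gamma>\<^sup>2\<bar> > 2 * \<bar>\<alpha> + \<beta> * \<gamma>\<bar>"
    and "filterlim k at_top F" "filterlim l at_top F"
  shows "((\<lambda>n. green_energy \<alpha> \<beta> \<gamma> (k n) (l n)) \<longlongrightarrow> stationary_variance \<alpha> \<beta> \<gamma>) F"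
proof -
  note * = stable_regime[OF assms(2,3,4)]
  show ?thesis unfolding stationary_variance_eq[OF *]
    by (rule green_energy_tendsto_total[OF assms(1) row_energy_sums_total[OF assms(1) *] assms(5,6)])
qed

section \<open>Asymptotics of the row sums on the critical line\<close>

lemma cos_taylor_bounds:
  fixes x :: real
  shows "1 - x\<^sup>2 / 2 \<le> cos x" "cos x \<le> 1 - x\<^sup>2 / 2 + x ^ 4 / 24"
proof -
  obtain t where "cos x = (\<Sum>m<2. cos_coeff m * x ^ m) + (cos (t + 1/2 * real 2 * pi) / fact 2) * x ^ 2"
    using Maclaurin_cos_expansion[of x 2] by blast
  then have "cos x = 1 - cos t * (x\<^sup>2 / 2)" by (simp add: numeral_eq_Suc cos_coeff_def)
  moreover have "cos t * (x\<^sup>2 / 2) \<le> x\<^sup>2 / 2"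
    using mult_right_mono[OF cos_le_one[of t], of "x\<^sup>2 / 2"] by simp
  ultimately show "1 - x\<^sup>2 / 2 \<le> cos x" by simp
next
  obtain t where *: "cos x = (\<Sum>m<4. cos_coeff m * x ^ m) + (cos (t + 1/2 * real 4 * pi) / fact 4) * x ^ 4"
    using Maclaurin_cos_expansion[of x 4] by blast
  have "cos x = 1 - x\<^sup>2 / 2 + cos t * (x ^ 4 / 24)"
  proof -
    have "{..<4 :: nat} = {0, 1, 2, 3}" by auto
    then show ?thesis using * by (simp add: cos_coeff_def fact_numeral)
  qed
  moreover have "cos t * (x ^ 4 / 24) \<le> x ^ 4 / 24"
    using mult_right_mono[OF cos_le_one[of t], of "x ^ 4 / 24"] by simp
  ultimately show "cos x \<le> 1 - x\<^sup>2 / 2 + x ^ 4 / 24" by simp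
qed

text \<open>Half angles: 1 - cos x = 2 sin^2 y = 2 (1 - cos y)(1 + cos y) with y = x/2. Here cos y
  \<ge> 0, and y^2 \<le> 4 turns the quartic Taylor bound into 1 - cos y \<ge> y^2/3.\<close>

lemma one_minus_cos_ge:
  fixes x :: real
  assumes "\<bar>x\<bar> \<le> pi"
  shows "x\<^sup>2 / 6 \<le> 1 - cos x"
proof -
  define y where "y = x / 2"
  have y: "\<bar>y\<bar> \<le> pi / 2" using assms by (simp add: y_def)
  then have "\<bar>y\<bar> \<le> 2" using pi_half_le_two by linarith
  then have "y\<^sup>2 \<le> 4" using power_mono[of "\<bar>y\<bar>" 2 2] by simp
  then have "y ^ 4 \<le> 4 * y\<^sup>2"
    using mult_right_mono[of "y\<^sup>2" 4 "y\<^sup>2"] by (simp add: power4_eq_xxxx power2_eq_square)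
  with cos_taylor_bounds(2)[of y] have "y\<^sup>2 / 3 \<le> 1 - cos y" by simp
  moreover have "0 \<le> cos y" using y by (intro cos_ge_zero) auto
  ultimately have "y\<^sup>2 / 3 * 1 \<le> (1 - cos y) * (1 + cos y)" by (intro mult_mono) auto
  also have "\<dots> = (sin y)\<^sup>2" by (simp add: sin_squared_eq power2_eq_square algebra_simps)
  finally show ?thesis
    using cos_double_sin[of y] by (simp add: y_def power_divide)
qed

lemma tendsto_nat_times_one_minus_cos:
  "(\<lambda>j. real j * (1 - cos (y / sqrt (real j)))) \<longlonglongrightarrow> y\<^sup>2 / 2"
proof (rule tendsto_sandwich)
  have "y\<^sup>2 / 2 - y ^ 4 / 24 / real j \<le> real j * (1 - cos (y / sqrt (real j)))"
    "real j * (1 - cos (y / sqrt (real j))) \<le> y\<^sup>2 / 2" if "0 < j" for j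
  proof -
    have p: "(y / sqrt (real j))\<^sup>2 = y\<^sup>2 / real j" by (simp add: power_divide)
    have "(y / sqrt (real j)) ^ 4 = ((y / sqrt (real j))\<^sup>2)\<^sup>2" by simp
    then have p4: "(y / sqrt (real j)) ^ 4 = y ^ 4 / (real j)\<^sup>2"
      unfolding p by (simp add: power_divide)
    have "real j * (y\<^sup>2 / real j / 2 - y ^ 4 / (real j)\<^sup>2 / 24) = y\<^sup>2 / 2 - y ^ 4 / 24 / real j"
      using that by (simp add: field_simps power2_eq_square)
    moreover have "real j * (y\<^sup>2 / real j / 2 - y ^ 4 / (real j)\<^sup>2 / 24) \<le> real j * (1 - cos (y / sqrt (real j)))"
      using cos_taylor_bounds(2)[of "y / sqrt (real j)"] unfolding p p4 by (intro mult_left_mono) auto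
    ultimately show "y\<^sup>2 / 2 - y ^ 4 / 24 / real j \<le> real j * (1 - cos (y / sqrt (real j)))"
      by simp
    have "real j * (1 - cos (y / sqrt (real j))) \<le> real j * (y\<^sup>2 / real j / 2)"
      using cos_taylor_bounds(1)[of "y / sqrt (real j)"] unfolding p by (intro mult_left_mono) auto
    then show "real j * (1 - cos (y / sqrt (real j))) \<le> y\<^sup>2 / 2"
      using that by simp
  qed
  then show "\<forall>\<^sub>F j in sequentially. y\<^sup>2 / 2 - y ^ 4 / 24 / real j \<le> real j * (1 - cos (y / sqrt (real j)))"
    "\<forall>\<^sub>F j in sequentially. real j * (1 - cos (y / sqrt (real j))) \<le> y\<^sup>2 / 2"
    by (auto intro: eventually_mono[OF eventually_gt_at_top[of 0]])
  show "(\<lambda>j. y\<^sup>2 / 2 - y ^ 4 / 24 / real j) \<longlonglongrightarrow> y\<^sup>2 / 2"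
    using tendsto_diff[OF tendsto_const lim_const_over_n[of "y ^ 4 / 24"], of "y\<^sup>2 / 2"] by simp
qed simp

text \<open>Squeezed by 1 - a \<le> exp(-a) from above and, from below, by the same inequality
  applied to 1/(1 - a) = 1 + a/(1 - a).\<close>

lemma tendsto_one_minus_power_exp:
  fixes a :: "nat \<Rightarrow> real"
  assumes nonneg: "\<And>n. 0 \<le> a n" and lim: "(\<lambda>n. real n * a n) \<longlonglongrightarrow> x"
  shows "(\<lambda>n. (1 - a n) ^ n) \<longlonglongrightarrow> exp (- x)"
proof (rule tendsto_sandwich)
  have "(\<lambda>n. (1 / real n) * (real n * a n)) \<longlonglongrightarrow> 0 * x"
    by (intro tendsto_mult lim lim_1_over_n)
  moreover have "\<forall>\<^sub>F n in sequentially. (1 / real n) * (real n * a n) = a n"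
    using eventually_gt_at_top[of 0] by eventually_elim simp
  ultimately have a0: "a \<longlonglongrightarrow> 0" using Lim_transform_eventually by fastforce
  then have ev: "\<forall>\<^sub>F n in sequentially. a n < 1" by (simp add: order_tendsto_iff)
  show "\<forall>\<^sub>F n in sequentially. exp (- (real n * a n / (1 - a n))) \<le> (1 - a n) ^ n"
    using ev
  proof eventually_elim
    case (elim n)
    have "1 / (1 - a n) \<le> exp (a n / (1 - a n))"
      using exp_ge_add_one_self[of "a n / (1 - a n)"] elim by (simp add: field_simps)
    then have "exp (- (a n / (1 - a n))) \<le> 1 - a n"
      using elim by (simp add: exp_minus field_simps)
    from power_mono[OF this, of n] show ?case by (simp flip: exp_of_nat_mult)
  qed
  show "\<forall>\<^sub>F n in sequentially. (1 - a n) ^ n \<le> exp (- (real n * a n))"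
    using ev
  proof eventually_elim
    case (elim n)
    have "1 - a n \<le> exp (- a n)" using exp_ge_add_one_self[of "- a n"] by simp
    from power_mono[OF this, of n] elim show ?case by (simp flip: exp_of_nat_mult)
  qed
  have "(\<lambda>n. exp (- (real n * a n / (1 - a n)))) \<longlonglongrightarrow> exp (- (x / (1 - 0)))"
    by (intro tendsto_intros lim a0) simp
  then show "(\<lambda>n. exp (- (real n * a n / (1 - a n)))) \<longlonglongrightarrow> exp (- x)" by simp
  show "(\<lambda>n. exp (- (real n * a n))) \<longlonglongrightarrow> exp (- x)"
    by (intro tendsto_intros lim)
qed

lemma gaussian_integral:
  assumes "0 < (c :: real)"
  shows "integrable lborel (\<lambda>y. exp (- (c * y\<^sup>2)))" "(LBINT y. exp (- (c * y\<^sup>2))) = sqrt (pi / c)"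
proof -
  define \<sigma> where "\<sigma> = 1 / sqrt (2 * c)"
  have \<sigma>: "0 < \<sigma>" "\<sigma>\<^sup>2 = 1 / (2 * c)" using assms by (simp_all add: \<sigma>_def power_divide)
  have eq: "exp (- (c * y\<^sup>2)) = sqrt (pi / c) * normal_density 0 \<sigma> y" for y
    using assms by (simp add: normal_density_def \<sigma>(2) real_sqrt_divide field_simps)
  show "integrable lborel (\<lambda>y. exp (- (c * y\<^sup>2)))"
    unfolding eq using \<sigma> by (intro integrable_mult_right integrable_normal_density)
  show "(LBINT y. exp (- (c * y\<^sup>2))) = sqrt (pi / c)"
    unfolding eq using \<sigma> by (simp add: integral_normal_density)
qed

lemma lim_const_over_sqrt_n:
  "(\<lambda>n. c / sqrt (real n)) \<longlonglongrightarrow> (0 :: real)"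
  by (intro tendsto_divide_0[OF tendsto_const filterlim_at_top_imp_at_infinity]
    filterlim_compose[OF sqrt_at_top filterlim_real_sequentially])

text \<open>A Stolz-Cesaro argument: the telescoping increments of the square root sum exactly to
  \<open>sqrt N\<close> and are asymptotic to 1/(2 sqrt j), so \<open>a j\<close> is compared with
  them instead of with 1/sqrt j.\<close>

lemma sum_over_sqrt_tendsto:
  fixes a :: "nat \<Rightarrow> real"
  assumes lim: "(\<lambda>j. sqrt (real j) * a j) \<longlonglongrightarrow> c"
  shows "(\<lambda>N. (\<Sum>j<N. a j) / sqrt (real N)) \<longlonglongrightarrow> 2 * c"
proof (rule LIMSEQ_I)
  fix \<epsilon> :: real assume "0 < \<epsilon>"
  define b where "b = (\<lambda>j. sqrt (real (Suc j)) - sqrt (real j))"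
  have b_pos: "0 < b j" for j by (simp add: b_def)
  have b_sum: "(\<Sum>j<N. b j) = sqrt (real N)" for N by (induction N) (simp_all add: b_def)
  have b_eq: "1 / b j = sqrt (real (Suc j)) + sqrt (real j)" for j
  proof -
    have "b j * (sqrt (real (Suc j)) + sqrt (real j)) = 1"
      by (simp add: b_def algebra_simps)
    then show ?thesis using b_pos[of j] by (simp add: field_simps)
  qed
  have "(\<lambda>j. sqrt (1 + 1 / real j) + 1) \<longlonglongrightarrow> sqrt (1 + 0) + 1"
    by (intro tendsto_intros lim_1_over_n)
  from tendsto_mult[OF this lim]
  have "(\<lambda>j. (sqrt (1 + 1 / real j) + 1) * (sqrt (real j) * a j)) \<longlonglongrightarrow> 2 * c" by simp
  moreover have "\<forall>\<^sub>F j in sequentially. (sqrt (1 + 1 / real j) + 1) * (sqrt (real j) * a j) = a j / b j"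
    using eventually_gt_at_top[of 0]
  proof eventually_elim
    case (elim j)
    have "sqrt (1 + 1 / real j) * sqrt (real j) = sqrt (real (Suc j))"
      using elim by (simp add: real_sqrt_mult[symmetric] algebra_simps)
    then have "(sqrt (1 + 1 / real j) + 1) * (sqrt (real j) * a j) = a j * (1 / b j)"
      unfolding b_eq by (simp add: algebra_simps)
    then show ?case by simp
  qed
  ultimately have "(\<lambda>j. a j / b j) \<longlonglongrightarrow> 2 * c"
    by (rule Lim_transform_eventually)
  from LIMSEQ_D[OF this, of "\<epsilon> / 2"] \<open>0 < \<epsilon>\<close>
  obtain J where J: "\<forall>j\<ge>J. \<bar>a j / b j - 2 * c\<bar> < \<epsilon> / 2" by auto
  \<comment> \<open>The error of the finitely many indices before \<open>J\<close>, which division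
    by \<open>sqrt N\<close> makes vanish.\<close>
  define D where "D = (\<Sum>j<J. \<bar>a j - 2 * c * b j\<bar>)"
  have diff: "\<bar>(\<Sum>j<N. a j) - 2 * c * sqrt (real N)\<bar> \<le> D + \<epsilon> / 2 * sqrt (real N)" for N
  proof -
    have "(\<Sum>j<N. a j) - 2 * c * sqrt (real N) = (\<Sum>j<N. a j - 2 * c * b j)"
      by (simp add: sum_subtractf sum_distrib_left[symmetric] b_sum)
    also have "\<bar>\<dots>\<bar> \<le> (\<Sum>j<N. \<bar>a j - 2 * c * b j\<bar>)" by (rule sum_abs)
    also have "\<dots> \<le> (\<Sum>j<N. (if j < J then \<bar>a j - 2 * c * b j\<bar> else 0) + \<epsilon> / 2 * b j)"
    proof (rule sum_mono)
      fix j
      show "\<bar>a j - 2 * c * b j\<bar> \<le> (if j < J then \<bar>a j - 2 * c * b j\<bar> else 0) + \<epsilon> / 2 * b j"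
      proof (cases "j < J")
        case False
        have "a j - 2 * c * b j = (a j / b j - 2 * c) * b j"
          using b_pos[of j] by (simp add: left_diff_distrib)
        then have "\<bar>a j - 2 * c * b j\<bar> = \<bar>a j / b j - 2 * c\<bar> * b j"
          using b_pos[of j] by (simp add: abs_mult)
        also have "\<dots> \<le> \<epsilon> / 2 * b j"
          using J[rule_format, of j] False b_pos[of j] by (intro mult_right_mono) auto
        finally show ?thesis using False by simp
      qed (use \<open>0 < \<epsilon>\<close> b_pos[of j] in simp)
    qed
    also have "\<dots> \<le> D + \<epsilon> / 2 * sqrt (real N)"
    proof -
      have "(\<Sum>j<N. if j < J then \<bar>a j - 2 * c * b j\<bar> else 0) = (\<Sum>j\<in>{..<N} \<inter> {..<J}. \<bar>a j - 2 * c * b j\<bar>)"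
        by (subst sum.inter_restrict) auto
      also have "\<dots> \<le> D" unfolding D_def by (intro sum_mono2) auto
      finally show ?thesis unfolding sum.distrib sum_distrib_left[symmetric] b_sum by simp
    qed
    finally show ?thesis .
  qed
  have "(\<lambda>N. D / sqrt (real N)) \<longlonglongrightarrow> 0"
    by (rule lim_const_over_sqrt_n)
  then have "\<forall>\<^sub>F N in sequentially. D / sqrt (real N) < \<epsilon> / 2"
    by (rule order_tendstoD(2)) (use \<open>0 < \<epsilon>\<close> in simp)
  then have "\<forall>\<^sub>F N in sequentially. norm ((\<Sum>j<N. a j) / sqrt (real N) - 2 * c) < \<epsilon>"
    using eventually_gt_at_top[of 0]
  proof eventually_elim
    case (elim N)
    have "norm ((\<Sum>j<N. a j) / sqrt (real N) - 2 * c) = \<bar>(\<Sum>j<N. a j) - 2 * c * sqrt (real N)\<bar> / sqrt (real N)"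
      using elim(2) by (simp add: divide_simps)
    also have "\<dots> \<le> (D + \<epsilon> / 2 * sqrt (real N)) / sqrt (real N)"
      using diff by (intro divide_right_mono) auto
    also have "\<dots> = D / sqrt (real N) + \<epsilon> / 2" using elim(2) by (simp add: field_simps)
    finally show ?case using elim(1) by linarith
  qed
  then show "\<exists>no. \<forall>n\<ge>no. norm ((\<Sum>j<n. a j) / sqrt (real n) - 2 * c) < \<epsilon>"
    by (simp add: eventually_sequentially)
qed

text \<open>Laplace's method. On the critical line the ratio of numerator to denominator in the row
  integral is 1 - g with g of quadratic order at \<theta> = 0. Substituting \<theta> = y / sqrt j
  turns (1 - g)^j into a Gaussian, under Gaussian domination.\<close>

lemma sqrt_times_row_energy_tendsto:
  assumes \<alpha>: "0 \<le> \<alpha>" "\<alpha> < 1" and \<beta>: "\<beta> < 1" and pos: "0 < \<alpha> + \<beta>" and crit: "\<alpha> + \<beta> + \<gamma> = 1"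
  shows "(\<lambda>j. sqrt (real j) * row_energy \<alpha> \<beta> \<gamma> j)
    \<longlonglongrightarrow> 1 / (2 * sqrt pi * (1 - \<alpha>) * sqrt ((1 - \<beta>) * (\<alpha> + \<beta>)))"
\<comment> \<open>The index is shifted because the substitution degenerates at
  \<open>j = 0\<close>.\<close>
proof (rule LIMSEQ_imp_Suc)
  \<comment> \<open>By \<open>crit\<close> this equals \<alpha> + \<beta> \<gamma>; the difference
    of denominator and numerator is then 2u (1 - cos \<theta>), vanishing at \<theta> = 0, unlike in
    the stable regime.\<close>
  define u where "u = (1 - \<beta>) * (\<alpha> + \<beta>)"
  define d where "d = (\<lambda>\<theta>. 1 + \<alpha>\<^sup>2 - 2 * \<alpha> * cos \<theta>)"
  define g where "g = (\<lambda>\<theta>. 2 * u * (1 - cos \<theta>) / d \<theta>)"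
  \<comment> \<open>The row integrand after \<theta> = y / sqrt j, whose Jacobian cancels the factor
    \<open>sqrt j\<close>; the indicator carries the growing integration range.\<close>
  define H where "H = (\<lambda>j y. indicator {- pi..pi} (y / sqrt (real j)) *
    ((1 - g (y / sqrt (real j))) ^ j / d (y / sqrt (real j))))"
  have u: "0 < u" using \<beta> pos by (simp add: u_def)
  have \<gamma>: "\<gamma> = 1 - \<alpha> - \<beta>" using crit by simp
  have "\<bar>\<alpha>\<bar> < 1" using \<alpha> by simp
  note d_facts = row_denominator_pos[OF this]
  have d_pos: "0 < d \<theta>" and d_ge: "(1 - \<alpha>)\<^sup>2 \<le> d \<theta>" for \<theta>
    using d_facts[of \<theta>] \<alpha> by (simp_all add: d_def)
  have d_le: "d \<theta> \<le> 4" for \<theta>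
  proof -
    have "\<bar>\<alpha> * cos \<theta>\<bar> \<le> \<bar>\<alpha>\<bar>" by (simp add: abs_mult mult_left_le)
    then show ?thesis using \<alpha> abs_square_less_1[of \<alpha>] by (simp add: d_def)
  qed
  have g_nonneg: "0 \<le> g \<theta>" for \<theta>
    using u d_pos[of \<theta>] by (simp add: g_def)
  have num: "\<beta>\<^sup>2 + \<gamma>\<^sup>2 + 2 * \<beta> * \<gamma> * cos \<theta> = (1 - g \<theta>) * d \<theta>" for \<theta>
  proof -
    have "(1 - g \<theta>) * d \<theta> = d \<theta> - 2 * u * (1 - cos \<theta>)"
      using d_pos[of \<theta>] by (simp add: g_def field_simps)
    then show ?thesis by (simp add: d_def u_def \<gamma> power2_eq_square algebra_simps)
  qed
  have g_le_1: "g \<theta> \<le> 1" for \<theta>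
  proof -
    have "\<beta>\<^sup>2 + \<gamma>\<^sup>2 + 2 * \<beta> * \<gamma> * cos \<theta> = (\<beta> + \<gamma> * cos \<theta>)\<^sup>2 + (\<gamma> * sin \<theta>)\<^sup>2"
      using sin_cos_squared_add[of \<theta>] by algebra
    then have "0 \<le> (1 - g \<theta>) * d \<theta>" unfolding num[symmetric] by simp
    then show ?thesis using d_pos[of \<theta>] by (simp add: zero_le_mult_iff)
  qed
  have g_ge: "u / 12 * \<theta>\<^sup>2 \<le> g \<theta>" if "\<bar>\<theta>\<bar> \<le> pi" for \<theta>
  proof -
    \<comment> \<open>The constant combines 1 - cos \<theta> \<ge> \<theta>^2/6 with d \<le>
      4.\<close>
    have "u / 12 * \<theta>\<^sup>2 = 2 * u * (\<theta>\<^sup>2 / 6) / 4" by simp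
    also have "\<dots> \<le> 2 * u * (1 - cos \<theta>) / d \<theta>"
      using u d_pos[of \<theta>] d_le[of \<theta>] one_minus_cos_ge[OF that] by (intro frac_le mult_left_mono) auto
    finally show ?thesis by (simp add: g_def)
  qed
  have row: "row_energy \<alpha> \<beta> \<gamma> j = 1 / (2 * pi) * (LBINT \<theta>. indicator {- pi..pi} \<theta> * ((1 - g \<theta>) ^ j / d \<theta>))" for j
  proof -
    have "(\<beta>\<^sup>2 + \<gamma>\<^sup>2 + 2 * \<beta> * \<gamma> * cos \<theta>) ^ j / (1 + \<alpha>\<^sup>2 - 2 * \<alpha> * cos \<theta>) ^ Suc j = (1 - g \<theta>) ^ j / d \<theta>" for \<theta>
    proof -
      have "1 + \<alpha>\<^sup>2 - 2 * \<alpha> * cos \<theta> = d \<theta>" by (simp add: d_def)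
      then show ?thesis using d_pos[of \<theta>] unfolding num by (simp add: power_mult_distrib)
    qed
    then show ?thesis
      by (simp add: row_energy_integral(2)[OF \<open>\<bar>\<alpha>\<bar> < 1\<close>] integral_circ)
  qed
  have scaled: "sqrt (real j) * row_energy \<alpha> \<beta> \<gamma> j = 1 / (2 * pi) * (LBINT y. H j y)" if "0 < j" for j
    unfolding row using that lborel_integral_real_affine[of "1 / sqrt (real j)"
      "\<lambda>\<theta>. indicator {- pi..pi} \<theta> * ((1 - g \<theta>) ^ j / d \<theta>)" 0]
    by (simp add: H_def)
  have meas [measurable]: "d \<in> borel_measurable borel" "g \<in> borel_measurable borel"
    unfolding d_def g_def by measurable
  have lim_H: "(\<lambda>j. H j y) \<longlonglongrightarrow> exp (- (u / (1 - \<alpha>)\<^sup>2 * y\<^sup>2)) / (1 - \<alpha>)\<^sup>2" for y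
  proof -
    have y0: "(\<lambda>j. y / sqrt (real j)) \<longlonglongrightarrow> 0"
      by (rule lim_const_over_sqrt_n)
    have "(\<lambda>j. d (y / sqrt (real j))) \<longlonglongrightarrow> 1 + \<alpha>\<^sup>2 - 2 * \<alpha> * cos 0"
      unfolding d_def by (intro tendsto_intros y0)
    then have lim_d: "(\<lambda>j. d (y / sqrt (real j))) \<longlonglongrightarrow> (1 - \<alpha>)\<^sup>2"
      by (simp add: power2_eq_square algebra_simps)
    have "(\<lambda>j. 2 * u * (real j * (1 - cos (y / sqrt (real j)))) / d (y / sqrt (real j))) \<longlonglongrightarrow>
        2 * u * (y\<^sup>2 / 2) / (1 - \<alpha>)\<^sup>2"
      using \<alpha> by (intro tendsto_intros lim_d tendsto_nat_times_one_minus_cos) auto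
    then have "(\<lambda>j. real j * g (y / sqrt (real j))) \<longlonglongrightarrow> u / (1 - \<alpha>)\<^sup>2 * y\<^sup>2"
      by (simp add: g_def mult_ac)
    from tendsto_one_minus_power_exp[OF g_nonneg this]
    have "(\<lambda>j. (1 - g (y / sqrt (real j))) ^ j / d (y / sqrt (real j)))
        \<longlonglongrightarrow> exp (- (u / (1 - \<alpha>)\<^sup>2 * y\<^sup>2)) / (1 - \<alpha>)\<^sup>2"
      using \<alpha> by (intro tendsto_divide lim_d) auto
    moreover have "\<forall>\<^sub>F j in sequentially. \<bar>y / sqrt (real j)\<bar> < pi"
      using order_tendstoD(2)[OF tendsto_rabs[OF y0]] by simp
    then have "\<forall>\<^sub>F j in sequentially. (1 - g (y / sqrt (real j))) ^ j / d (y / sqrt (real j)) = H j y"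
    proof eventually_elim
      case (elim j)
      then have "y / sqrt (real j) \<in> {- pi..pi}"
        by (simp only: atLeastAtMost_iff abs_less_iff) linarith
      then show ?case by (simp add: H_def)
    qed
    ultimately show ?thesis by (rule Lim_transform_eventually)
  qed
  have bound_H: "norm (H (Suc j) y) \<le> exp (- (u / 12 * y\<^sup>2)) / (1 - \<alpha>)\<^sup>2" for j y
  proof (cases "\<bar>y / sqrt (real (Suc j))\<bar> \<le> pi")
    case True
    define \<theta> where "\<theta> = y / sqrt (real (Suc j))"
    have "norm (H (Suc j) y) \<le> (1 - g \<theta>) ^ Suc j / d \<theta>"
      using g_le_1[of \<theta>] d_pos[of \<theta>] by (simp add: H_def \<theta>_def indicator_def)
    also have "\<dots> \<le> exp (- (u / 12 * \<theta>\<^sup>2)) ^ Suc j / (1 - \<alpha>)\<^sup>2"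
    proof (intro frac_le power_mono)
      have "1 - g \<theta> \<le> exp (- g \<theta>)" using exp_ge_add_one_self[of "- g \<theta>"] by simp
      also have "\<dots> \<le> exp (- (u / 12 * \<theta>\<^sup>2))" using g_ge[of \<theta>] True by (simp add: \<theta>_def)
      finally show "1 - g \<theta> \<le> exp (- (u / 12 * \<theta>\<^sup>2))" .
    qed (use g_le_1[of \<theta>] d_ge[of \<theta>] \<alpha> in auto)
    also have "exp (- (u / 12 * \<theta>\<^sup>2)) ^ Suc j = exp (- (u / 12 * y\<^sup>2))"
    proof -
      have "\<theta>\<^sup>2 = y\<^sup>2 / real (Suc j)" by (simp add: \<theta>_def power_divide)
      then show ?thesis by (subst exp_of_nat_mult[symmetric]) (simp del: of_nat_Suc)
    qed
    finally show ?thesis .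
  next
    case False
    then have "y / sqrt (real (Suc j)) \<notin> {- pi..pi}" by (simp only: atLeastAtMost_iff abs_le_iff) linarith
    then show ?thesis by (simp add: H_def)
  qed
  have "(\<lambda>j. LBINT y. H (Suc j) y) \<longlonglongrightarrow> (LBINT y. exp (- (u / (1 - \<alpha>)\<^sup>2 * y\<^sup>2)) / (1 - \<alpha>)\<^sup>2)"
  proof (rule integral_dominated_convergence)
    show "integrable lborel (\<lambda>y. exp (- (u / 12 * y\<^sup>2)) / (1 - \<alpha>)\<^sup>2)"
      using u by (intro integrable_divide_zero gaussian_integral) simp
    show "AE y in lborel. (\<lambda>j. H (Suc j) y) \<longlonglongrightarrow> exp (- (u / (1 - \<alpha>)\<^sup>2 * y\<^sup>2)) / (1 - \<alpha>)\<^sup>2"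
      using lim_H by (intro AE_I2 LIMSEQ_Suc)
    show "AE y in lborel. norm (H (Suc j) y) \<le> exp (- (u / 12 * y\<^sup>2)) / (1 - \<alpha>)\<^sup>2" for j
      using bound_H by simp
  qed (simp_all add: H_def)
  also have "(LBINT y. exp (- (u / (1 - \<alpha>)\<^sup>2 * y\<^sup>2)) / (1 - \<alpha>)\<^sup>2) = sqrt (pi / (u / (1 - \<alpha>)\<^sup>2)) / (1 - \<alpha>)\<^sup>2"
  proof -
    have "0 < u / (1 - \<alpha>)\<^sup>2" using u \<alpha> by simp
    from gaussian_integral(2)[OF this] show ?thesis by (simp only: integral_divide_zero)
  qed
  also have "\<dots> = sqrt pi / ((1 - \<alpha>) * sqrt u)"
    using \<alpha> by (simp add: real_sqrt_divide real_sqrt_mult power2_eq_square)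
  finally have "(\<lambda>j. 1 / (2 * pi) * (LBINT y. H (Suc j) y)) \<longlonglongrightarrow> 1 / (2 * pi) * (sqrt pi / ((1 - \<alpha>) * sqrt u))"
    by (intro tendsto_mult tendsto_const)
  also have "1 / (2 * pi) * (sqrt pi / ((1 - \<alpha>) * sqrt u)) = 1 / (2 * sqrt pi * (1 - \<alpha>) * sqrt u)"
  proof -
    have "sqrt pi / pi = 1 / sqrt pi" by (simp add: field_simps)
    moreover have "1 / (2 * pi) * (sqrt pi / ((1 - \<alpha>) * sqrt u)) = (sqrt pi / pi) * (1 / (2 * ((1 - \<alpha>) * sqrt u)))"
      by simp
    ultimately show ?thesis by simp
  qed
  finally show "(\<lambda>j. sqrt (real (Suc j)) * row_energy \<alpha> \<beta> \<gamma> (Suc j))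
      \<longlonglongrightarrow> 1 / (2 * sqrt pi * (1 - \<alpha>) * sqrt ((1 - \<beta>) * (\<alpha> + \<beta>)))"
    unfolding scaled[OF zero_less_Suc] u_def .
qed

section \<open>Concentration around the drift\<close>

lemma sum_geometric_le:
  fixes q :: real
  assumes "0 \<le> q" "q < 1" "finite J"
  shows "(\<Sum>j\<in>J. q ^ j) \<le> 1 / (1 - q)"
proof -
  have s: "(\<lambda>j. q ^ j) sums (1 / (1 - q))" using assms by (intro geometric_sums) simp
  show ?thesis
    unfolding sums_unique[OF s] using assms by (intro sum_le_suminf sums_summable[OF s]) auto
qed

text \<open>The offset \<open>c\<close> covers the two roundings used later: 0 when the row count
  must satisfy \<kappa> N \<le> k, and 1 when it must reach k \<le> \<kappa> N.\<close>

lemma nat_floor_div_tendsto: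
  fixes k :: "nat \<Rightarrow> nat"
  assumes k: "(\<lambda>n. real (k n) / real n) \<longlonglongrightarrow> s" and \<kappa>: "0 < \<kappa>"
  shows "(\<lambda>n. real (nat \<lfloor>real (k n) / \<kappa>\<rfloor> + c) / real n) \<longlonglongrightarrow> s / \<kappa>"
proof (rule tendsto_sandwich)
  have *: "real (k n) / \<kappa> - 1 \<le> real (nat \<lfloor>real (k n) / \<kappa>\<rfloor> + c)"
    "real (nat \<lfloor>real (k n) / \<kappa>\<rfloor> + c) \<le> real (k n) / \<kappa> + real c" for n
  proof -
    have "0 \<le> real (k n) / \<kappa>" using \<kappa> by simp
    then show "real (k n) / \<kappa> - 1 \<le> real (nat \<lfloor>real (k n) / \<kappa>\<rfloor> + c)"
      "real (nat \<lfloor>real (k n) / \<kappa>\<rfloor> + c) \<le> real (k n) / \<kappa> + real c" by linarith+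
  qed
  show "\<forall>\<^sub>F n in sequentially. real (k n) / real n / \<kappa> - 1 / real n \<le> real (nat \<lfloor>real (k n) / \<kappa>\<rfloor> + c) / real n"
  proof (intro always_eventually allI)
    show "real (k n) / real n / \<kappa> - 1 / real n \<le> real (nat \<lfloor>real (k n) / \<kappa>\<rfloor> + c) / real n" for n
      using divide_right_mono[OF *(1)[of n], of "real n"] by (simp add: diff_divide_distrib mult.commute)
  qed
  show "\<forall>\<^sub>F n in sequentially. real (nat \<lfloor>real (k n) / \<kappa>\<rfloor> + c) / real n \<le> real (k n) / real n / \<kappa> + real c / real n"
  proof (intro always_eventually allI)
    show "real (nat \<lfloor>real (k n) / \<kappa>\<rfloor> + c) / real n \<le> real (k n) / real n / \<kappa> + real c / real n" for n
      using divide_right_mono[OF *(2)[of n], of "real n"] by (simp add: add_divide_distrib mult.commute)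
  qed
  have "(\<lambda>n. real (k n) / real n / \<kappa> - 1 / real n) \<longlonglongrightarrow> s / \<kappa> - 0"
    using \<kappa> by (intro tendsto_diff tendsto_divide k tendsto_const lim_1_over_n) auto
  then show "(\<lambda>n. real (k n) / real n / \<kappa> - 1 / real n) \<longlonglongrightarrow> s / \<kappa>" by simp
  have "(\<lambda>n. real (k n) / real n / \<kappa> + real c / real n) \<longlonglongrightarrow> s / \<kappa> + 0"
    using \<kappa> by (intro tendsto_add tendsto_divide k tendsto_const lim_const_over_n) auto
  then show "(\<lambda>n. real (k n) / real n / \<kappa> + real c / real n) \<longlonglongrightarrow> s / \<kappa>" by simp
qed

text \<open>The critical case after sign normalisation; \<gamma> may still be negative.
  \<open>pos\<close> excludes the deterministic walk with \<alpha> = \<beta> = 0 and \<gamma> = 1,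
  whose row sums do not decay.\<close>

locale critical_ar =
  fixes \<alpha> \<beta> \<gamma> :: real
  assumes \<alpha>: "0 \<le> \<alpha>" "\<alpha> < 1" and \<beta>: "0 \<le> \<beta>" "\<beta> < 1"
    and pos: "0 < \<alpha> + \<beta>" and crit: "\<alpha> + \<beta> + \<gamma> = 1"
begin

text \<open>\<open>step_pgf\<close> is the probability generating function of a step of the random walk whose mass
  function after \<open>j\<close> steps, convolved with a geometric law, is \<open>(1 - \<alpha>) * green i j\<close>;
  \<open>drift\<close> is its mean.\<close>

definition step_pgf :: "real \<Rightarrow> real" where
  "step_pgf r = (\<beta> + \<gamma> * r) / (1 - \<alpha> * r)"

definition drift :: real where
  "drift = (1 - \<beta>) / (1 - \<alpha>)"

lemma drift_pos: "0 < drift"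
  using \<alpha> \<beta> by (simp add: drift_def)

lemma green_nonneg: "0 \<le> green \<alpha> \<beta> \<gamma> i j"
  using \<alpha> \<beta> crit by (intro green_nonneg_critical) auto

lemma green_row_pgf:
  assumes "0 \<le> r" "\<alpha> * r < 1"
  shows "(\<lambda>i. green \<alpha> \<beta> \<gamma> i j * r ^ i) sums (step_pgf r ^ j / (1 - \<alpha> * r))"
proof -
  have "norm (of_real \<alpha> * r) < 1" using assms \<alpha> by simp
  from conjunct2[OF green_row_sums[OF this, of \<beta> \<gamma> j]] show ?thesis
    by (simp add: step_pgf_def power_divide mult.commute)
qed

lemma step_pgf_1: "step_pgf 1 = 1"
  using crit \<alpha> by (simp add: step_pgf_def)

text \<open>As \<gamma> may be negative, the sign is read off from row 1, whose generating function
  has nonnegative coefficients.\<close>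

lemma step_pgf_nonneg:
  assumes "0 \<le> r" "\<alpha> * r < 1"
  shows "0 \<le> step_pgf r"
proof -
  have "0 \<le> step_pgf r ^ 1 / (1 - \<alpha> * r)"
    using green_nonneg assms(1) by (intro sums_le[OF _ sums_zero green_row_pgf[OF assms]]) simp
  then show ?thesis using assms(2) by (simp add: zero_le_divide_iff)
qed

text \<open>Each row is nonnegative with total 1/(1 - \<alpha>). This bound removes one factor of
  the square in the Chernoff estimate.\<close>

lemma green_le: "green \<alpha> \<beta> \<gamma> i j \<le> 1 / (1 - \<alpha>)"
proof -
  have "(\<lambda>i. green \<alpha> \<beta> \<gamma> i j) sums (1 / (1 - \<alpha>))"
    using green_row_pgf[of 1 j] \<alpha> by (simp add: step_pgf_1)
  then show ?thesis
    using sum_le_suminf[of "\<lambda>i. green \<alpha> \<beta> \<gamma> i j" "{i}"] green_nonneg by (simp add: sums_iff)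
qed

text \<open>Exponential tilting by r^i. The condition on \<open>I\<close> is phrased so that it
  covers both sides: indices i \<ge> \<kappa> j with r > 1 and indices i \<le> \<kappa> j with r <
  1.\<close>

lemma chernoff_green_sq:
  assumes r: "0 < r" "\<alpha> * r < 1" and "finite I"
    and I: "\<And>i. i \<in> I \<Longrightarrow> r powr (\<kappa> * real j) \<le> r ^ i"
  shows "(\<Sum>i\<in>I. (green \<alpha> \<beta> \<gamma> i j)\<^sup>2)
    \<le> 1 / ((1 - \<alpha>) * (1 - \<alpha> * r)) * (step_pgf r * r powr - \<kappa>) ^ j"
proof -
  define w where "w = r powr (\<kappa> * real j)"
  have w: "0 < w" using r by (simp add: w_def)
  have w_inv: "1 / w = (r powr - \<kappa>) ^ j"
    using r by (simp add: w_def powr_minus powr_powr[symmetric] powr_realpow power_inverse divide_inverse)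
  have "(\<Sum>i\<in>I. (green \<alpha> \<beta> \<gamma> i j)\<^sup>2) \<le> (\<Sum>i\<in>I. 1 / (1 - \<alpha>) * (green \<alpha> \<beta> \<gamma> i j * r ^ i / w))"
  proof (rule sum_mono)
    fix i assume "i \<in> I"
    then have "1 \<le> r ^ i / w" using I w by (simp add: w_def)
    then have "green \<alpha> \<beta> \<gamma> i j * 1 \<le> green \<alpha> \<beta> \<gamma> i j * (r ^ i / w)"
      using green_nonneg by (intro mult_left_mono)
    then show "(green \<alpha> \<beta> \<gamma> i j)\<^sup>2 \<le> 1 / (1 - \<alpha>) * (green \<alpha> \<beta> \<gamma> i j * r ^ i / w)"
      unfolding power2_eq_square using green_nonneg green_le \<alpha>
      by (intro mult_mono) auto
  qed
  also have "\<dots> = 1 / (1 - \<alpha>) * ((\<Sum>i\<in>I. green \<alpha> \<beta> \<gamma> i j * r ^ i) / w)"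
    by (simp add: sum_distrib_left sum_divide_distrib)
  also have "\<dots> \<le> 1 / (1 - \<alpha>) * (step_pgf r ^ j / (1 - \<alpha> * r) / w)"
  proof (intro mult_left_mono divide_right_mono)
    have s: "(\<lambda>i. green \<alpha> \<beta> \<gamma> i j * r ^ i) sums (step_pgf r ^ j / (1 - \<alpha> * r))"
      using r by (intro green_row_pgf) auto
    show "(\<Sum>i\<in>I. green \<alpha> \<beta> \<gamma> i j * r ^ i) \<le> step_pgf r ^ j / (1 - \<alpha> * r)"
      unfolding sums_unique[OF s] using r green_nonneg \<open>finite I\<close>
      by (intro sum_le_suminf sums_summable[OF s]) auto
  qed (use w \<alpha> in auto)
  also have "\<dots> = 1 / ((1 - \<alpha>) * (1 - \<alpha> * r)) * (step_pgf r * r powr - \<kappa>) ^ j"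
    by (simp add: power_mult_distrib flip: w_inv)
  finally show ?thesis .
qed

text \<open>The Chernoff base equals 1 at r = 1, so a nonzero slope there lets a small move of
  \<open>r\<close> push it below 1: to the right if \<kappa> exceeds the drift, to the left if
  \<kappa> is smaller.\<close>

lemma deriv_tilted_pgf:
  "((\<lambda>r. step_pgf r * r powr - \<kappa>) has_real_derivative (drift - \<kappa>)) (at 1)"
proof -
  have \<gamma>: "\<gamma> = 1 - \<alpha> - \<beta>" using crit by simp
  have "(step_pgf has_real_derivative drift) (at 1)"
  proof -
    have "step_pgf = (\<lambda>r. (\<beta> + \<gamma> * r) / (1 - \<alpha> * r))"
      by (simp add: fun_eq_iff step_pgf_def)
    moreover have "((\<lambda>r. (\<beta> + \<gamma> * r) / (1 - \<alpha> * r)) has_real_derivative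
        (\<gamma> * (1 - \<alpha> * 1) - (\<beta> + \<gamma> * 1) * - \<alpha>) / ((1 - \<alpha> * 1) * (1 - \<alpha> * 1))) (at 1)"
      using \<alpha> by (auto intro!: derivative_eq_intros)
    moreover have "\<gamma> * (1 - \<alpha> * 1) - (\<beta> + \<gamma> * 1) * - \<alpha> = (1 - \<beta>) * (1 - \<alpha>)"
      by (simp add: \<gamma> algebra_simps)
    ultimately show ?thesis using \<alpha> by (simp add: drift_def)
  qed
  moreover have "((\<lambda>r. r powr - \<kappa>) has_real_derivative - \<kappa> * 1 powr (- \<kappa> - 1)) (at 1)"
    by (rule has_real_derivative_powr) simp
  ultimately have "((\<lambda>r. step_pgf r * r powr - \<kappa>) has_real_derivative
      drift * 1 powr - \<kappa> + - \<kappa> * 1 powr (- \<kappa> - 1) * step_pgf 1) (at 1)"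
    by (rule DERIV_mult)
  then show ?thesis by (simp add: step_pgf_1)
qed

lemma row_tail_above_drift:
  assumes "drift < \<kappa>"
  obtains C q where "0 \<le> q" "q < 1" "0 \<le> C"
    "\<And>j k. \<kappa> * real j \<le> real k \<Longrightarrow>
      row_energy \<alpha> \<beta> \<gamma> j - (\<Sum>i<k. (green \<alpha> \<beta> \<gamma> i j)\<^sup>2) \<le> C * q ^ j"
proof -
  obtain \<delta> where \<delta>: "0 < \<delta>" "\<And>h. 0 < h \<Longrightarrow> h < \<delta> \<Longrightarrow> step_pgf (1 + h) * (1 + h) powr - \<kappa> < 1"
    using DERIV_neg_dec_right[OF deriv_tilted_pgf[of \<kappa>]] assms by (auto simp: step_pgf_1)
  \<comment> \<open>\<open>\<delta> / 2\<close> keeps the Chernoff base below 1, and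
    \<open>(1 - \<alpha>) / 2\<close> keeps \<alpha> r < 1, so that the row series converges at
    \<open>r\<close>.\<close>
  define h where "h = min (\<delta> / 2) ((1 - \<alpha>) / 2)"
  define r where "r = 1 + h"
  have h: "0 < h" "h < \<delta>" "h \<le> (1 - \<alpha>) / 2"
    using \<delta>(1) \<alpha> min.cobounded2[of "\<delta> / 2" "(1 - \<alpha>) / 2"] unfolding h_def by (auto simp del: min.cobounded2)
  have r: "1 < r" using h by (simp add: r_def)
  have "\<alpha> * h \<le> h" using \<alpha> h by (simp add: mult_left_le_one_le)
  then have "\<alpha> + \<alpha> * h < 1" using h(3) \<alpha> by argo
  then have \<alpha>r: "\<alpha> * r < 1" by (simp add: r_def algebra_simps)
  define q where "q = step_pgf r * r powr - \<kappa>"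
  define C where "C = 1 / ((1 - \<alpha>) * (1 - \<alpha> * r))"
  show ?thesis
  proof (rule that)
    show "0 \<le> q" using step_pgf_nonneg[of r] r \<alpha>r by (simp add: q_def)
    show "q < 1" using \<delta>(2) h by (simp add: q_def r_def)
    show "0 \<le> C" using \<alpha> \<alpha>r by (simp add: C_def)
    fix j k assume jk: "\<kappa> * real j \<le> real k"
    have "\<bar>\<alpha>\<bar> < 1" using \<alpha> by simp
    \<comment> \<open>The tail of the row is infinite while the Chernoff bound is for finite index
      sets, so it is applied to \<open>{k..<m}\<close> and \<open>m\<close> tends to
      infinity.\<close>
    have "(\<lambda>m. \<Sum>i<m. (green \<alpha> \<beta> \<gamma> i j)\<^sup>2) \<longlonglongrightarrow> row_energy \<alpha> \<beta> \<gamma> j"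
      using row_energy_integral(1)[OF \<open>\<bar>\<alpha>\<bar> < 1\<close>] by (simp add: sums_def)
    then have "row_energy \<alpha> \<beta> \<gamma> j \<le> (\<Sum>i<k. (green \<alpha> \<beta> \<gamma> i j)\<^sup>2) + C * q ^ j"
    proof (rule LIMSEQ_le_const2, intro exI allI impI)
      fix m assume "k \<le> m"
      then have "{..<m} = {..<k} \<union> {k..<m}" by auto
      then have "(\<Sum>i<m. (green \<alpha> \<beta> \<gamma> i j)\<^sup>2) = (\<Sum>i<k. (green \<alpha> \<beta> \<gamma> i j)\<^sup>2) + (\<Sum>i=k..<m. (green \<alpha> \<beta> \<gamma> i j)\<^sup>2)"
        by (simp add: sum.union_disjoint ivl_disj_int)
      also have "(\<Sum>i=k..<m. (green \<alpha> \<beta> \<gamma> i j)\<^sup>2) \<le> C * q ^ j"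
        unfolding C_def q_def
      proof (rule chernoff_green_sq)
        fix i assume "i \<in> {k..<m}"
        then have "r powr (\<kappa> * real j) \<le> r powr real i"
          using r jk by (intro powr_mono) auto
        then show "r powr (\<kappa> * real j) \<le> r ^ i" using r by (simp add: powr_realpow)
      qed (use r \<alpha>r in auto)
      finally show "(\<Sum>i<m. (green \<alpha> \<beta> \<gamma> i j)\<^sup>2) \<le> (\<Sum>i<k. (green \<alpha> \<beta> \<gamma> i j)\<^sup>2) + C * q ^ j" by simp
    qed
    then show "row_energy \<alpha> \<beta> \<gamma> j - (\<Sum>i<k. (green \<alpha> \<beta> \<gamma> i j)\<^sup>2) \<le> C * q ^ j" by simp
  qed
qed

lemma row_head_below_drift:
  assumes "\<kappa> < drift"
  obtains C q where "0 \<le> q" "q < 1" "0 \<le> C"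
    "\<And>j k. real k \<le> \<kappa> * real j \<Longrightarrow> (\<Sum>i<k. (green \<alpha> \<beta> \<gamma> i j)\<^sup>2) \<le> C * q ^ j"
proof -
  obtain \<delta> where \<delta>: "0 < \<delta>" "\<And>h. 0 < h \<Longrightarrow> h < \<delta> \<Longrightarrow> step_pgf (1 - h) * (1 - h) powr - \<kappa> < 1"
    using DERIV_pos_inc_left[OF deriv_tilted_pgf[of \<kappa>]] assms by (auto simp: step_pgf_1)
  \<comment> \<open>The cap \<open>1 / 2\<close> keeps \<open>r\<close> positive; \<alpha> r < 1
    follows from r < 1.\<close>
  define h where "h = min (\<delta> / 2) (1 / 2)"
  define r where "r = 1 - h"
  have h: "0 < h" "h < \<delta>" "h \<le> 1 / 2" using \<delta>(1) by (auto simp: h_def)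
  then have r: "0 < r" "r < 1" by (simp_all add: r_def)
  then have "\<alpha> * r \<le> \<alpha>" using \<alpha> by (simp add: mult_left_le)
  then have \<alpha>r: "\<alpha> * r < 1" using \<alpha> by simp
  define q where "q = step_pgf r * r powr - \<kappa>"
  define C where "C = 1 / ((1 - \<alpha>) * (1 - \<alpha> * r))"
  show ?thesis
  proof (rule that)
    show "0 \<le> q" using step_pgf_nonneg[of r] r \<alpha>r by (simp add: q_def)
    show "q < 1" using \<delta>(2) h by (simp add: q_def r_def)
    show "0 \<le> C" using \<alpha> \<alpha>r by (simp add: C_def)
    fix j k assume jk: "real k \<le> \<kappa> * real j"
    show "(\<Sum>i<k. (green \<alpha> \<beta> \<gamma> i j)\<^sup>2) \<le> C * q ^ j"
      unfolding C_def q_def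
    proof (rule chernoff_green_sq)
      fix i assume "i \<in> {..<k}"
      then have "r powr (\<kappa> * real j) \<le> r powr real i"
        using r jk by (intro powr_mono') auto
      then show "r powr (\<kappa> * real j) \<le> r ^ i" using r by (simp add: powr_realpow)
    qed (use r \<alpha>r in auto)
  qed
qed

text \<open>Rows before \<open>N\<close> are bounded by their full sums. Any later row has k \<le>
  \<kappa> N \<le> \<kappa> j, so only its head below the drift counts, and these heads sum
  geometrically to a constant independent of \<open>k\<close>, \<open>l\<close> and
  \<open>N\<close>; for l \<le> N no later rows occur.\<close>

lemma green_energy_le:
  assumes "0 \<le> \<kappa>" "\<kappa> < drift"
  obtains C where "\<And>k l N. l \<le> N \<or> real k \<le> \<kappa> * real N \<Longrightarrow>
    green_energy \<alpha> \<beta> \<gamma> k l \<le> (\<Sum>j<N. row_energy \<alpha> \<beta> \<gamma> j) + C"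
proof -
  obtain C q where q: "0 \<le> q" "q < 1" and C: "0 \<le> C"
    and head: "\<And>j k. real k \<le> \<kappa> * real j \<Longrightarrow> (\<Sum>i<k. (green \<alpha> \<beta> \<gamma> i j)\<^sup>2) \<le> C * q ^ j"
    using row_head_below_drift[OF assms(2)] by metis
  have "\<bar>\<alpha>\<bar> < 1" using \<alpha> by simp
  note row_le = sum_green_sq_le_row_energy[OF this]
  show ?thesis
  proof (rule that)
    fix k l N assume A: "l \<le> N \<or> real k \<le> \<kappa> * real N"
    have row_nonneg: "0 \<le> row_energy \<alpha> \<beta> \<gamma> j" for j using row_le[where k=0] by simp
    have "green_energy \<alpha> \<beta> \<gamma> k l \<le> (\<Sum>j<l. (if j < N then row_energy \<alpha> \<beta> \<gamma> j else 0) + C * q ^ j)"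
      unfolding green_energy_def
    proof (rule sum_mono)
      fix j assume "j \<in> {..<l}"
      show "(\<Sum>i<k. (green \<alpha> \<beta> \<gamma> i j)\<^sup>2) \<le> (if j < N then row_energy \<alpha> \<beta> \<gamma> j else 0) + C * q ^ j"
      proof (cases "j < N")
        case True
        then show ?thesis using row_le[where k=k and j=j] C q by (simp add: add_increasing2)
      next
        case False
        with A \<open>j \<in> {..<l}\<close> have "real k \<le> \<kappa> * real N" by auto
        also have "\<dots> \<le> \<kappa> * real j" using False assms(1) by (intro mult_left_mono) auto
        finally show ?thesis using head False by simp
      qed
    qed
    also have "\<dots> = (\<Sum>j\<in>{..<l} \<inter> {..<N}. row_energy \<alpha> \<beta> \<gamma> j) + C * (\<Sum>j<l. q ^ j)"
      unfolding sum.distrib sum_distrib_left by (subst sum.inter_restrict) auto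
    also have "\<dots> \<le> (\<Sum>j<N. row_energy \<alpha> \<beta> \<gamma> j) + C * (1 / (1 - q))"
      using C q row_nonneg by (intro add_mono mult_left_mono sum_geometric_le sum_mono2) auto
    finally show "green_energy \<alpha> \<beta> \<gamma> k l \<le> (\<Sum>j<N. row_energy \<alpha> \<beta> \<gamma> j) + C * (1 / (1 - q))" .
  qed
qed

text \<open>Every row before \<open>N\<close> has \<kappa> j \<le> k, hence loses only its tail
  above the drift; these tails sum geometrically to a uniform constant.\<close>

lemma green_energy_ge:
  assumes "drift < \<kappa>"
  obtains C where "\<And>k l N. N \<le> l \<Longrightarrow> \<kappa> * real N \<le> real k \<Longrightarrow>
    (\<Sum>j<N. row_energy \<alpha> \<beta> \<gamma> j) - C \<le> green_energy \<alpha> \<beta> \<gamma> k l"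
proof -
  obtain C q where q: "0 \<le> q" "q < 1" and C: "0 \<le> C"
    and tail: "\<And>j k. \<kappa> * real j \<le> real k \<Longrightarrow>
      row_energy \<alpha> \<beta> \<gamma> j - (\<Sum>i<k. (green \<alpha> \<beta> \<gamma> i j)\<^sup>2) \<le> C * q ^ j"
    using row_tail_above_drift[OF assms] by metis
  show ?thesis
  proof (rule that)
    fix k l N assume N: "N \<le> l" "\<kappa> * real N \<le> real k"
    have "(\<Sum>j<N. row_energy \<alpha> \<beta> \<gamma> j) \<le> (\<Sum>j<N. (\<Sum>i<k. (green \<alpha> \<beta> \<gamma> i j)\<^sup>2) + C * q ^ j)"
    proof (rule sum_mono)
      fix j assume "j \<in> {..<N}"
      then have "\<kappa> * real j \<le> \<kappa> * real N"
        using assms drift_pos by (intro mult_left_mono) auto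
      then show "row_energy \<alpha> \<beta> \<gamma> j \<le> (\<Sum>i<k. (green \<alpha> \<beta> \<gamma> i j)\<^sup>2) + C * q ^ j"
        using tail[of j k] N(2) by simp
    qed
    also have "\<dots> = green_energy \<alpha> \<beta> \<gamma> k N + C * (\<Sum>j<N. q ^ j)"
      by (simp add: green_energy_def sum.distrib sum_distrib_left)
    also have "\<dots> \<le> green_energy \<alpha> \<beta> \<gamma> k l + C * (1 / (1 - q))"
      using C q N by (intro add_mono mult_left_mono sum_geometric_le green_energy_mono) auto
    finally show "(\<Sum>j<N. row_energy \<alpha> \<beta> \<gamma> j) - C * (1 / (1 - q)) \<le> green_energy \<alpha> \<beta> \<gamma> k l" by simp
  qed
qed

section \<open>Growth of the variance on the critical line\<close>

definition growth_const :: real where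
  "growth_const = 1 / (sqrt pi * (1 - \<alpha>) * sqrt ((1 - \<beta>) * (\<alpha> + \<beta>)))"

text \<open>The sum is rescaled as (sum / sqrt N) sqrt(N/n). \<open>growth_const\<close> is twice
  the constant of \<open>sqrt_times_row_energy_tendsto\<close>, the 2 coming from summing 1/sqrt j.
  The bounded errors of \<open>green_energy_le\<close> and \<open>green_energy_ge\<close> enter as
  \<open>C\<close> and disappear.\<close>

lemma total_row_energy_scaled:
  fixes N :: "nat \<Rightarrow> nat"
  assumes N: "(\<lambda>n. real (N n) / real n) \<longlonglongrightarrow> x" and "0 < x"
  shows "(\<lambda>n. ((\<Sum>j<N n. row_energy \<alpha> \<beta> \<gamma> j) + C) / sqrt (real n)) \<longlonglongrightarrow> growth_const * sqrt x"
proof -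
  have "filterlim (\<lambda>n. real (N n) / real n * real n) at_top sequentially"
    by (rule filterlim_tendsto_pos_mult_at_top[OF N \<open>0 < x\<close> filterlim_real_sequentially])
  then have "filterlim (\<lambda>n. real (N n)) at_top sequentially"
    by (rule filterlim_mono_eventually[OF _ order.refl order.refl])
      (use eventually_gt_at_top[of 0] in \<open>eventually_elim, simp\<close>)
  then have N_top: "filterlim N at_top sequentially"
    by (simp add: filterlim_sequentially_iff_filterlim_real)
  have "(\<lambda>N. (\<Sum>j<N. row_energy \<alpha> \<beta> \<gamma> j) / sqrt (real N)) \<longlonglongrightarrow> growth_const"
    using sum_over_sqrt_tendsto[OF sqrt_times_row_energy_tendsto[OF \<alpha> \<beta>(2) pos crit]]
    by (simp add: growth_const_def mult.assoc)
  from tendsto_mult[OF filterlim_compose[OF this N_top] tendsto_real_sqrt[OF N]]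
  have "(\<lambda>n. (\<Sum>j<N n. row_energy \<alpha> \<beta> \<gamma> j) / sqrt (real (N n)) * sqrt (real (N n) / real n) + C / sqrt (real n))
      \<longlonglongrightarrow> growth_const * sqrt x + 0"
    by (intro tendsto_add lim_const_over_sqrt_n)
  moreover have "\<forall>\<^sub>F n in sequentially.
      (\<Sum>j<N n. row_energy \<alpha> \<beta> \<gamma> j) / sqrt (real (N n)) * sqrt (real (N n) / real n) + C / sqrt (real n)
      = ((\<Sum>j<N n. row_energy \<alpha> \<beta> \<gamma> j) + C) / sqrt (real n)"
  proof -
    have "\<forall>\<^sub>F n in sequentially. 0 < N n"
      by (rule eventually_compose_filterlim[OF eventually_gt_at_top N_top])
    then show ?thesis by eventually_elim (simp add: real_sqrt_divide add_divide_distrib)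
  qed
  ultimately show ?thesis using Lim_transform_eventually by fastforce
qed

text \<open>A threshold \<kappa> above the drift gives the asymptotic lower bound \<psi> \<kappa>,
  one below it the upper bound \<psi> \<kappa>; continuity of \<psi> at the drift closes the
  gap.\<close>

lemma green_energy_critical:
  assumes k: "(\<lambda>n. real (k n) / real n) \<longlonglongrightarrow> s" and l: "(\<lambda>n. real (l n) / real n) \<longlonglongrightarrow> t"
    and st: "0 < s" "0 < t"
  shows "(\<lambda>n. green_energy \<alpha> \<beta> \<gamma> (k n) (l n) / sqrt (real n))
    \<longlonglongrightarrow> growth_const * sqrt (min t (s / drift))"
proof -
  define \<psi> where "\<psi> = (\<lambda>\<kappa>. growth_const * sqrt (min t (s / \<kappa>)))"
  have \<psi>: "(\<psi> \<longlongrightarrow> \<psi> drift) (at drift within A)" for A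
    unfolding \<psi>_def using drift_pos by (intro tendsto_intros) auto
  have lim: "(\<lambda>n. ((\<Sum>j<min (l n) (nat \<lfloor>real (k n) / \<kappa>\<rfloor> + c). row_energy \<alpha> \<beta> \<gamma> j) + C) / sqrt (real n)) \<longlonglongrightarrow> \<psi> \<kappa>"
    if "0 < \<kappa>" for \<kappa> c C
    unfolding \<psi>_def
  proof (rule total_row_energy_scaled)
    have "(\<lambda>n. min (real (l n) / real n) (real (nat \<lfloor>real (k n) / \<kappa>\<rfloor> + c) / real n)) \<longlonglongrightarrow> min t (s / \<kappa>)"
      by (intro tendsto_min l nat_floor_div_tendsto k that)
    then show "(\<lambda>n. real (min (l n) (nat \<lfloor>real (k n) / \<kappa>\<rfloor> + c)) / real n) \<longlonglongrightarrow> min t (s / \<kappa>)"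
      by (simp add: min_divide_distrib_right of_nat_min)
  qed (use st that in simp)
  show ?thesis
  proof (rule order_tendstoI)
    fix a assume "a < growth_const * sqrt (min t (s / drift))"
    then have "\<forall>\<^sub>F \<kappa> in at_right drift. a < \<psi> \<kappa> \<and> drift < \<kappa>"
      using order_tendstoD(1)[OF \<psi>] eventually_at_right_less
      by (intro eventually_conj) (auto simp: \<psi>_def)
    then obtain \<kappa> where \<kappa>: "a < \<psi> \<kappa>" "drift < \<kappa>"
      using eventually_happens'[OF trivial_limit_at_right_real] by blast
    then have "0 < \<kappa>" using drift_pos by simp
    obtain C where C: "\<And>k l N. N \<le> l \<Longrightarrow> \<kappa> * real N \<le> real k \<Longrightarrow>
        (\<Sum>j<N. row_energy \<alpha> \<beta> \<gamma> j) - C \<le> green_energy \<alpha> \<beta> \<gamma> k l"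
      using green_energy_ge[OF \<kappa>(2)] by metis
    show "\<forall>\<^sub>F n in sequentially. a < green_energy \<alpha> \<beta> \<gamma> (k n) (l n) / sqrt (real n)"
      using order_tendstoD(1)[OF lim[OF \<open>0 < \<kappa>\<close>, of 0 "- C"] \<kappa>(1)]
    proof eventually_elim
      case (elim n)
      \<comment> \<open>Rounding down ensures \<kappa> N \<le> k, as \<open>green_energy_ge\<close>
        requires.\<close>
      let ?N = "min (l n) (nat \<lfloor>real (k n) / \<kappa>\<rfloor> + 0)"
      have "real ?N \<le> real (nat \<lfloor>real (k n) / \<kappa>\<rfloor>)" by simp
      also have "\<dots> \<le> real (k n) / \<kappa>" using \<open>0 < \<kappa>\<close> by (intro of_nat_floor) auto
      finally have "(\<Sum>j<?N. row_energy \<alpha> \<beta> \<gamma> j) - C \<le> green_energy \<alpha> \<beta> \<gamma> (k n) (l n)"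
        using \<open>0 < \<kappa>\<close> by (intro C) (auto simp: field_simps)
      then have "((\<Sum>j<?N. row_energy \<alpha> \<beta> \<gamma> j) + - C) / sqrt (real n)
          \<le> green_energy \<alpha> \<beta> \<gamma> (k n) (l n) / sqrt (real n)"
        by (intro divide_right_mono) auto
      with elim show ?case by linarith
    qed
  next
    fix a assume "growth_const * sqrt (min t (s / drift)) < a"
    then have "\<forall>\<^sub>F \<kappa> in at_left drift. \<psi> \<kappa> < a \<and> \<kappa> \<in> {0<..<drift}"
      using order_tendstoD(2)[OF \<psi>] eventually_at_left_real[OF drift_pos]
      by (intro eventually_conj) (auto simp: \<psi>_def)
    then obtain \<kappa> where \<kappa>: "\<psi> \<kappa> < a" "\<kappa> < drift" "0 < \<kappa>"
      using eventually_happens'[OF trivial_limit_at_left_real] by fastforce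
    obtain C where C: "\<And>k l N. l \<le> N \<or> real k \<le> \<kappa> * real N \<Longrightarrow>
        green_energy \<alpha> \<beta> \<gamma> k l \<le> (\<Sum>j<N. row_energy \<alpha> \<beta> \<gamma> j) + C"
      using green_energy_le[OF less_imp_le[OF \<kappa>(3)] \<kappa>(2)] by metis
    show "\<forall>\<^sub>F n in sequentially. green_energy \<alpha> \<beta> \<gamma> (k n) (l n) / sqrt (real n) < a"
      using order_tendstoD(2)[OF lim[OF \<kappa>(3), of 1 C] \<kappa>(1)]
    proof eventually_elim
      case (elim n)
      \<comment> \<open>The \<open>+ 1\<close> ensures k \<le> \<kappa> N unless the minimum is
        \<open>l n\<close>, matching the alternative in \<open>green_energy_le\<close>.\<close>
      let ?N = "min (l n) (nat \<lfloor>real (k n) / \<kappa>\<rfloor> + 1)"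
      have "real (k n) / \<kappa> \<le> real (nat \<lfloor>real (k n) / \<kappa>\<rfloor> + 1)" by linarith
      then have "real (k n) \<le> \<kappa> * real (nat \<lfloor>real (k n) / \<kappa>\<rfloor> + 1)"
        using \<kappa>(3) by (simp only: pos_divide_le_eq mult.commute)
      then have "l n \<le> ?N \<or> real (k n) \<le> \<kappa> * real ?N"
        by (cases "l n \<le> nat \<lfloor>real (k n) / \<kappa>\<rfloor> + 1") (simp_all add: min_absorb1 min_absorb2)
      then have "green_energy \<alpha> \<beta> \<gamma> (k n) (l n) \<le> (\<Sum>j<?N. row_energy \<alpha> \<beta> \<gamma> j) + C"
        by (rule C)
      then have "green_energy \<alpha> \<beta> \<gamma> (k n) (l n) / sqrt (real n)
          \<le> ((\<Sum>j<?N. row_energy \<alpha> \<beta> \<gamma> j) + C) / sqrt (real n)"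
        by (intro divide_right_mono) auto
      with elim show ?case by linarith
    qed
  qed
qed

text \<open>Both arguments of the minimum have denominator 1 - \<beta>, because s / drift = (1 -
  \<alpha>) s / (1 - \<beta>). Pulling it out restores the symmetry between the coordinates that the
  row-wise argument had hidden.\<close>

lemma growth_const_times_sqrt_min:
  "growth_const * sqrt (min t (s / drift)) =
    min (sqrt ((1 - \<alpha>) * s)) (sqrt ((1 - \<beta>) * t)) / (sqrt pi * sqrt (\<alpha> + \<beta>) * (1 - \<alpha>) * (1 - \<beta>))"
proof -
  define m where "m = min ((1 - \<alpha>) * s) ((1 - \<beta>) * t)"
  have "t = (1 - \<beta>) * t / (1 - \<beta>)" "s / drift = (1 - \<alpha>) * s / (1 - \<beta>)"
    using \<alpha> \<beta> by (simp_all add: drift_def)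
  then have "min t (s / drift) = min ((1 - \<beta>) * t / (1 - \<beta>)) ((1 - \<alpha>) * s / (1 - \<beta>))"
    by (simp only:)
  also have "\<dots> = m / (1 - \<beta>)"
    unfolding m_def using \<beta> by (subst min.commute) (simp add: min_divide_distrib_right)
  finally have "sqrt (min t (s / drift)) = sqrt m / sqrt (1 - \<beta>)" by (simp add: real_sqrt_divide)
  then have "growth_const * sqrt (min t (s / drift))
      = sqrt m / (sqrt pi * sqrt (\<alpha> + \<beta>) * (1 - \<alpha>) * (sqrt (1 - \<beta>) * sqrt (1 - \<beta>)))"
    by (simp add: growth_const_def real_sqrt_mult mult_ac)
  also have "sqrt (1 - \<beta>) * sqrt (1 - \<beta>) = 1 - \<beta>" using \<beta> by simp
  also have "sqrt m = min (sqrt ((1 - \<alpha>) * s)) (sqrt ((1 - \<beta>) * t))"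
    by (simp add: m_def min_def)
  finally show ?thesis .
qed

end

section \<open>Scaling limits\<close>

lemma filterlim_nat_floor_scale:
  assumes "0 < (s :: real)"
  shows "filterlim (\<lambda>n. nat \<lfloor>real n * s\<rfloor>) at_top sequentially"
  by (intro filterlim_compose[OF filterlim_nat_sequentially] filterlim_compose[OF filterlim_floor_sequentially]
      filterlim_at_top_mult_tendsto_pos[OF tendsto_const assms] filterlim_real_sequentially)

lemma nat_floor_scale_over_tendsto:
  assumes "0 \<le> (s :: real)"
  shows "(\<lambda>n. real (nat \<lfloor>real n * s\<rfloor>) / real n) \<longlonglongrightarrow> s"
proof (rule tendsto_sandwich)
  have *: "real n * s - 1 \<le> real (nat \<lfloor>real n * s\<rfloor>)" "real (nat \<lfloor>real n * s\<rfloor>) \<le> real n * s" for n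
    using assms by linarith (simp add: assms)
  have "s - 1 / real n \<le> real (nat \<lfloor>real n * s\<rfloor>) / real n" if "0 < n" for n
    using divide_right_mono[OF *(1)[of n], of "real n"] that by (simp add: diff_divide_distrib)
  then show "\<forall>\<^sub>F n in sequentially. s - 1 / real n \<le> real (nat \<lfloor>real n * s\<rfloor>) / real n"
    by (rule eventually_mono[OF eventually_gt_at_top[of 0]])
  have "real (nat \<lfloor>real n * s\<rfloor>) / real n \<le> s" if "0 < n" for n
    using divide_right_mono[OF *(2)[of n], of "real n"] that by simp
  then show "\<forall>\<^sub>F n in sequentially. real (nat \<lfloor>real n * s\<rfloor>) / real n \<le> s"
    by (rule eventually_mono[OF eventually_gt_at_top[of 0]])
  show "(\<lambda>n. s - 1 / real n) \<longlonglongrightarrow> s"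
    using tendsto_diff[OF tendsto_const lim_1_over_n, of s] by simp
qed simp

text \<open>Changing the signs of \<alpha> and \<beta> to nonnegative ones replaces \<gamma> by a
  number of the same modulus carrying the sign of \<alpha> \<beta> \<gamma>; both critical equations
  then say that the three new parameters sum to 1.\<close>

lemma green_energy_sign_normalize:
  assumes "\<alpha> * \<beta> * \<gamma> \<ge> 0 \<Longrightarrow> \<bar>\<alpha>\<bar> + \<bar>\<beta>\<bar> + \<bar>\<gamma>\<bar> = 1"
    and "\<alpha> * \<beta> * \<gamma> < 0 \<Longrightarrow> \<bar>\<alpha>\<bar> + \<bar>\<beta>\<bar> - \<bar>\<gamma>\<bar> = 1"
  shows "green_energy \<alpha> \<beta> \<gamma> = green_energy \<bar>\<alpha>\<bar> \<bar>\<beta>\<bar> (1 - \<bar>\<alpha>\<bar> - \<bar>\<beta>\<bar>)"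
proof -
  obtain \<epsilon> \<delta> :: real where sq: "\<epsilon>\<^sup>2 = 1" "\<delta>\<^sup>2 = 1"
    and eq: "\<epsilon> * \<alpha> = \<bar>\<alpha>\<bar>" "\<delta> * \<beta> = \<bar>\<beta>\<bar>" "\<epsilon> * \<delta> * \<gamma> = 1 - \<bar>\<alpha>\<bar> - \<bar>\<beta>\<bar>"
  proof -
    \<comment> \<open>Unlike \<open>sgn\<close>, this takes the value 1 at 0, so its square is
      always 1.\<close>
    define sg where "sg = (\<lambda>x :: real. if x < 0 then - 1 else 1 :: real)"
    have sg: "(sg x)\<^sup>2 = 1" "sg x * x = \<bar>x\<bar>" for x by (simp_all add: sg_def)
    consider "\<alpha> = 0" | "\<alpha> \<noteq> 0" "\<beta> = 0" | "\<alpha> \<noteq> 0" "\<beta> \<noteq> 0" by blast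
    then show thesis
    proof cases
      case 1
      \<comment> \<open>With \<alpha> = 0 the sign \<epsilon> is free and is spent on making the new
        \<gamma> nonnegative; the case \<beta> = 0 uses \<delta> in the same way.\<close>
      have "sg (sg \<beta> * \<gamma>) * sg \<beta> * \<gamma> = \<bar>\<gamma>\<bar>"
        using sg(2)[of "sg \<beta> * \<gamma>"] by (simp add: abs_mult mult.assoc) (simp add: sg_def)
      then show thesis using 1 assms(1) sg by (intro that[of "sg (sg \<beta> * \<gamma>)" "sg \<beta>"]) auto
    next
      case 2
      have "sg \<alpha> * sg (sg \<alpha> * \<gamma>) * \<gamma> = \<bar>\<gamma>\<bar>"
        using sg(2)[of "sg \<alpha> * \<gamma>"] by (simp add: abs_mult mult_ac) (simp add: sg_def)
      then show thesis using 2 assms(1) sg by (intro that[of "sg \<alpha>" "sg (sg \<alpha> * \<gamma>)"]) auto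
    next
      case 3
      define g where "g = sg \<alpha> * sg \<beta> * \<gamma>"
      have "\<bar>\<alpha>\<bar> * \<bar>\<beta>\<bar> * g = \<alpha> * \<beta> * \<gamma>" "\<bar>g\<bar> = \<bar>\<gamma>\<bar>" by (simp_all add: g_def sg_def)
      moreover have "0 < \<bar>\<alpha>\<bar> * \<bar>\<beta>\<bar>" using 3 by simp
      ultimately have "0 \<le> \<alpha> * \<beta> * \<gamma> \<longleftrightarrow> 0 \<le> g"
        using zero_le_mult_iff[of "\<bar>\<alpha>\<bar> * \<bar>\<beta>\<bar>" g] by (metis less_imp_le not_less)
      with \<open>\<bar>g\<bar> = \<bar>\<gamma>\<bar>\<close> assms have "g = 1 - \<bar>\<alpha>\<bar> - \<bar>\<beta>\<bar>" by (cases "0 \<le> g") auto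
      then show thesis using sg by (intro that[of "sg \<alpha>" "sg \<beta>"]) (simp_all add: g_def)
    qed
  qed
  show ?thesis
    using green_energy_sign_change[OF sq, of \<alpha> \<beta> \<gamma>] by (simp add: eq fun_eq_iff)
qed

text \<open>In the other case \<alpha> \<beta> = \<gamma>, the sign condition becomes \<gamma>^2
  \<le> 0, so both sides vanish.\<close>

lemma eq_neg_mult_if_abs_eq:
  fixes \<alpha> \<beta> \<gamma> :: real
  assumes "\<bar>\<alpha> * \<beta>\<bar> = \<bar>\<gamma>\<bar>" "\<alpha> * \<beta> * \<gamma> \<le> 0"
  shows "\<gamma> = - \<alpha> * \<beta>"
proof -
  have "\<alpha> * \<beta> = \<gamma> \<or> \<alpha> * \<beta> = - \<gamma>" using assms(1) by (simp add: abs_eq_iff)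
  moreover have "\<gamma> = 0" if "\<alpha> * \<beta> = \<gamma>" using assms(2) unfolding that by (auto simp: mult_le_0_iff)
  ultimately show ?thesis by auto
qed

lemma scaled_count_times_geometric:
  fixes q :: real
  assumes "0 \<le> s" "0 < t" "\<bar>q\<bar> < 1"
  shows "(\<lambda>n. 1 / real n * (real (nat \<lfloor>real n * s\<rfloor>) * (\<Sum>j<nat \<lfloor>real n * t\<rfloor>. (q\<^sup>2) ^ j)))
    \<longlonglongrightarrow> s / (1 - q\<^sup>2)"
proof -
  have "(\<lambda>j. (q\<^sup>2) ^ j) sums (1 / (1 - q\<^sup>2))"
    using assms(3) by (intro geometric_sums) (simp add: abs_square_less_1)
  then have "(\<lambda>n. \<Sum>j<nat \<lfloor>real n * t\<rfloor>. (q\<^sup>2) ^ j) \<longlonglongrightarrow> 1 / (1 - q\<^sup>2)"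
    unfolding sums_def by (rule filterlim_compose[OF _ filterlim_nat_floor_scale[OF assms(2)]])
  from tendsto_mult[OF nat_floor_scale_over_tendsto[OF assms(1)] this] show ?thesis
    by simp
qed

theorem theorem1p1:
  fixes M :: "'a measure" and e :: "nat \<Rightarrow> nat \<Rightarrow> 'a \<Rightarrow> real" and \<alpha> \<beta> \<gamma> :: real
  assumes "prob_space M"
    and "prob_space.indep_vars M (\<lambda>_. borel) (\<lambda>(k, l). e k l) ({1..} \<times> {1..})"
    and "\<And>k l. k \<ge> 1 \<Longrightarrow> l \<ge> 1 \<Longrightarrow> prob_space.expectation M (e k l) = 0"
    and "\<And>k l. k \<ge> 1 \<Longrightarrow> l \<ge> 1 \<Longrightarrow> prob_space.variance M (e k l) = 1"
  shows
    "(\<bar>\<alpha>\<bar> < 1 \<and> \<bar>\<beta>\<bar> < 1 \<and> \<bar>\<gamma>\<bar> < 1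
        \<and> \<bar>1 + \<alpha>\<^sup>2 - \<beta>\<^sup>2 - \<gamma>\<^sup>2\<bar> > 2 * \<bar>\<alpha> + \<beta> * \<gamma>\<bar> \<and> 1 - \<beta>\<^sup>2 > \<bar>\<alpha> + \<beta> * \<gamma>\<bar> \<longrightarrow>
      (\<forall>s>0. \<forall>t>0.
        (\<lambda>n. prob_space.variance M (ar_field \<alpha> \<beta> \<gamma> e n s t))
          \<longlonglongrightarrow> stationary_variance \<alpha> \<beta> \<gamma>))
   \<and> (\<bar>\<alpha>\<bar> < 1 \<and> \<bar>\<beta>\<bar> < 1 \<and> \<bar>\<gamma>\<bar> < 1
        \<and> (\<alpha> * \<beta> * \<gamma> \<ge> 0 \<longrightarrow> \<bar>\<alpha>\<bar> + \<bar>\<beta>\<bar> + \<bar>\<gamma>\<bar> = 1)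
        \<and> (\<alpha> * \<beta> * \<gamma> < 0 \<longrightarrow> \<bar>\<alpha>\<bar> + \<bar>\<beta>\<bar> - \<bar>\<gamma>\<bar> = 1) \<longrightarrow>
      (\<forall>s\<ge>0. \<forall>t\<ge>0.
        (\<lambda>n. 1 / sqrt (real n) * prob_space.variance M (ar_field \<alpha> \<beta> \<gamma> e n s t))
          \<longlonglongrightarrow> min (sqrt ((1 - \<bar>\<alpha>\<bar>) * s)) (sqrt ((1 - \<bar>\<beta>\<bar>) * t))
              / (sqrt pi * sqrt (\<bar>\<alpha>\<bar> + \<bar>\<beta>\<bar>) * (1 - \<bar>\<alpha>\<bar>) * (1 - \<bar>\<beta>\<bar>))))
   \<and> (\<alpha> * \<beta> * \<gamma> \<le> 0 \<and> \<bar>\<alpha>\<bar> = 1 \<and> \<bar>\<beta>\<bar> = \<bar>\<gamma>\<bar> \<and> \<bar>\<gamma>\<bar> < 1 \<longrightarrow>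
      (\<forall>s\<ge>0. \<forall>t>0.
        (\<lambda>n. 1 / real n * prob_space.variance M (ar_field \<alpha> \<beta> \<gamma> e n s t))
          \<longlonglongrightarrow> s / (1 - \<gamma>\<^sup>2)))
   \<and> (\<alpha> * \<beta> * \<gamma> \<le> 0 \<and> \<bar>\<beta>\<bar> = 1 \<and> \<bar>\<alpha>\<bar> = \<bar>\<gamma>\<bar> \<and> \<bar>\<gamma>\<bar> < 1 \<longrightarrow>
      (\<forall>s>0. \<forall>t\<ge>0.
        (\<lambda>n. 1 / real n * prob_space.variance M (ar_field \<alpha> \<beta> \<gamma> e n s t))
          \<longlonglongrightarrow> t / (1 - \<gamma>\<^sup>2)))
   \<and> (\<alpha> * \<beta> * \<gamma> = -1 \<and> \<bar>\<alpha>\<bar> = 1 \<and> \<bar>\<beta>\<bar> = 1 \<and> \<bar>\<gamma>\<bar> = 1 \<longrightarrow>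
      (\<forall>s\<ge>0. \<forall>t\<ge>0.
        (\<lambda>n. 1 / (real n)\<^sup>2 * prob_space.variance M (ar_field \<alpha> \<beta> \<gamma> e n s t))
          \<longlonglongrightarrow> s * t))"
proof -
  interpret prob_space M by fact
  let ?V = "\<lambda>n s t. variance (ar_field \<alpha> \<beta> \<gamma> e n s t)"
  have V: "?V n s t = green_energy \<alpha> \<beta> \<gamma> (nat \<lfloor>real n * s\<rfloor>) (nat \<lfloor>real n * t\<rfloor>)" for n s t
    unfolding ar_field_def by (rule variance_spatial_ar) (use assms in auto)

  have stable: "(\<lambda>n. ?V n s t) \<longlonglongrightarrow> stationary_variance \<alpha> \<beta> \<gamma>"
    if "\<bar>\<alpha>\<bar> < 1" "\<bar>\<beta>\<bar> < 1" "\<bar>\<gamma>\<bar> < 1"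
      "\<bar>1 + \<alpha>\<^sup>2 - \<beta>\<^sup>2 - \<gamma>\<^sup>2\<bar> > 2 * \<bar>\<alpha> + \<beta> * \<gamma>\<bar>" "0 < s" "0 < t" for s t
    unfolding V by (intro green_energy_stable filterlim_nat_floor_scale that)

  have critical: "(\<lambda>n. 1 / sqrt (real n) * ?V n s t) \<longlonglongrightarrow>
      min (sqrt ((1 - \<bar>\<alpha>\<bar>) * s)) (sqrt ((1 - \<bar>\<beta>\<bar>) * t))
        / (sqrt pi * sqrt (\<bar>\<alpha>\<bar> + \<bar>\<beta>\<bar>) * (1 - \<bar>\<alpha>\<bar>) * (1 - \<bar>\<beta>\<bar>))"
    if bounds: "\<bar>\<alpha>\<bar> < 1" "\<bar>\<beta>\<bar> < 1" "\<bar>\<gamma>\<bar> < 1"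
      and crit: "\<alpha> * \<beta> * \<gamma> \<ge> 0 \<longrightarrow> \<bar>\<alpha>\<bar> + \<bar>\<beta>\<bar> + \<bar>\<gamma>\<bar> = 1"
        "\<alpha> * \<beta> * \<gamma> < 0 \<longrightarrow> \<bar>\<alpha>\<bar> + \<bar>\<beta>\<bar> - \<bar>\<gamma>\<bar> = 1"
      and st: "0 \<le> s" "0 \<le> t" for s t
  proof (cases "s = 0 \<or> t = 0")
    case True
    \<comment> \<open>On the axes \<open>green_energy_critical\<close> does not apply, but there the
      field is identically 0 and the minimum in the limit is 0.\<close>
    then have "?V n s t = 0" for n unfolding V by (auto simp: green_energy_def)
    moreover have "min (sqrt ((1 - \<bar>\<alpha>\<bar>) * s)) (sqrt ((1 - \<bar>\<beta>\<bar>) * t)) = 0"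
      using True st bounds by (auto simp: min.absorb1 min.absorb2)
    ultimately show ?thesis by simp
  next
    case False
    \<comment> \<open>If both vanished, the critical equation would read |\<gamma>| = 1.\<close>
    have "\<alpha> \<noteq> 0 \<or> \<beta> \<noteq> 0" using bounds(3) crit(1) by auto
    then interpret C: critical_ar "\<bar>\<alpha>\<bar>" "\<bar>\<beta>\<bar>" "1 - \<bar>\<alpha>\<bar> - \<bar>\<beta>\<bar>"
      by unfold_locales (use bounds in auto)
    have norm: "green_energy \<alpha> \<beta> \<gamma> = green_energy \<bar>\<alpha>\<bar> \<bar>\<beta>\<bar> (1 - \<bar>\<alpha>\<bar> - \<bar>\<beta>\<bar>)"
      using crit by (intro green_energy_sign_normalize) auto
    have "(\<lambda>n. ?V n s t / sqrt (real n)) \<longlonglongrightarrow> C.growth_const * sqrt (min t (s / C.drift))"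
      unfolding V norm
      using False st
      by (intro C.green_energy_critical nat_floor_scale_over_tendsto) auto
    then show ?thesis by (simp add: C.growth_const_times_sqrt_min)
  qed

  have unit_\<alpha>: "(\<lambda>n. 1 / real n * ?V n s t) \<longlonglongrightarrow> s / (1 - \<gamma>\<^sup>2)"
    if "\<alpha> * \<beta> * \<gamma> \<le> 0" "\<bar>\<alpha>\<bar> = 1" "\<bar>\<beta>\<bar> = \<bar>\<gamma>\<bar>" "\<bar>\<gamma>\<bar> < 1" "0 \<le> s" "0 < t" for s t
  proof -
    have "\<gamma> = - \<alpha> * \<beta>" using that by (intro eq_neg_mult_if_abs_eq) (auto simp: abs_mult)
    moreover have "\<alpha>\<^sup>2 = 1" "\<beta>\<^sup>2 = \<gamma>\<^sup>2" using that by (metis power2_abs one_power2)+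
    ultimately show ?thesis
      using that scaled_count_times_geometric[of s t \<gamma>] unfolding V
      by (simp add: green_energy_product)
  qed

  have unit_\<beta>: "(\<lambda>n. 1 / real n * ?V n s t) \<longlonglongrightarrow> t / (1 - \<gamma>\<^sup>2)"
    if "\<alpha> * \<beta> * \<gamma> \<le> 0" "\<bar>\<beta>\<bar> = 1" "\<bar>\<alpha>\<bar> = \<bar>\<gamma>\<bar>" "\<bar>\<gamma>\<bar> < 1" "0 < s" "0 \<le> t" for s t
  proof -
    have "\<gamma> = - \<alpha> * \<beta>" using that by (intro eq_neg_mult_if_abs_eq) (auto simp: abs_mult)
    moreover have "\<beta>\<^sup>2 = 1" "\<alpha>\<^sup>2 = \<gamma>\<^sup>2" using that by (metis power2_abs one_power2)+
    ultimately show ?thesis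
      using that scaled_count_times_geometric[of t s \<gamma>] unfolding V
      by (simp add: green_energy_product mult.commute)
  qed

  have unit_all: "(\<lambda>n. 1 / (real n)\<^sup>2 * ?V n s t) \<longlonglongrightarrow> s * t"
    if "\<alpha> * \<beta> * \<gamma> = -1" "\<bar>\<alpha>\<bar> = 1" "\<bar>\<beta>\<bar> = 1" "\<bar>\<gamma>\<bar> = 1" "0 \<le> s" "0 \<le> t" for s t
  proof -
    have "\<gamma> = - \<alpha> * \<beta>" using that by (intro eq_neg_mult_if_abs_eq) (auto simp: abs_mult)
    moreover have "\<alpha>\<^sup>2 = 1" "\<beta>\<^sup>2 = 1" using that by (metis power2_abs one_power2)+
    ultimately show ?thesis
      using tendsto_mult[OF nat_floor_scale_over_tendsto[OF that(5)] nat_floor_scale_over_tendsto[OF that(6)]]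
      unfolding V by (simp add: green_energy_product power2_eq_square)
  qed

  show ?thesis
    using stable critical unit_\<alpha> unit_\<beta> unit_all by blast
qed

end
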